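(* Let $\mathcal{P}$ be a finite or infinite set of primes, let $R=\mathbb{Z}[\{p^{-1}: p\in\mathcal{P}\}]$ and let $\Sigma_{\mathcal{P}}=X_{\mathcal{P}}/\Delta(R)$ be the associated solenoid over the circle $S^1$. Let $\{A_j:\mathbf{x}\mapsto (m_j/n_j)\mathbf{x}+\mathbf{a}_j \mid j\in\mathbb{N}\}$ be any family of affine surjective endomorphisms of $\Sigma_{\mathcal{P}}$ such that (1) none of the $A_j$ is a non-trivial translation of $\Sigma_{\mathcal{P}}$ (i.e. there is no $j$ with $m_j/n_j=1$ and $\mathbf{a}_j\neq \mathbf{0}$), and (2) the rational numbers $m_j/n_j$, $j\in\mathbb{N}$, all belong to a ring $\mathbb{Z}[1/q_1,\dots,1/q_s]$ for some finite set of primes $q_1,\dots,q_s\in\mathcal{P}$. Then there exists a cylinder absolute winning subset $F\subset\Sigma_{\mathcal{P}}$ such that for every $x\in F$ and every $j\in\mathbb{N}$, the orbit closure $\overline{\{A_j^k x\mid k\ge 0\}}$ contains no periodic $B$-orbit, for any $B\in R\setminus\{\pm1\}$.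
   Context: Setting. $\mathcal{P}=\{p_1<p_2<\cdots\}$ is a set of primes. $X_{\mathcal{P}}=\mathbb{R}\times\prod'_{p\in\mathcal{P}}\mathbb{Q}_p$ is the restricted product: elements are $\mathbf{x}=(x_0,x_1,x_2,\dots)$ with $x_0\in\mathbb{R}$, $x_i\in\mathbb{Q}_{p_i}$, and $x_i\in\mathbb{Z}_{p_i}$ for all but finitely many $i$; coordinate $0$ is the real one. The metric is $d(\mathbf{x},\mathbf{z})=\max\{|x_0-z_0|,\ \sup_{i\ge1}p_i^{-1}|x_i-z_i|_{p_i}\}$, with $|\cdot|_p$ the usual $p$-adic absolute value ($|p|_p=1/p$). $\overline{B}(\mathbf{x},r)=\{\mathbf{z}: d(\mathbf{x},\mathbf{z})\le r\}$ is the closed ball of radius $r>0$. $R$ is embedded diagonally by $\Delta$ in $X_{\mathcal{P}}$ as a uniform lattice, and $\Pi:X_{\mathcal{P}}\to\Sigma_{\mathcal{P}}$ is the quotient map. Elements of $R$ act on $\Sigma_{\mathcal{P}}$ by componentwise multiplication. An affine surjective endomorphism of $\Sigma_{\mathcal{P}}$ is a map $\mathbf{x}\mapsto (m/n)\mathbf{x}+\mathbf{a}$ with $m/n\in R\setminus\{0\}$ and $\mathbf{a}\in\Sigma_{\mathcal{P}}$. For $B\in R$, a periodic $B$-orbit is a set $\{B^k y: k\ge0\}$ with $y\in\Sigma_{\mathcal{P}}$ and $B^q y=y$ for some $q\ge1$. Cylinders. For $\mathbf{x}\in X_{\mathcal{P}}$, $\varepsilon>0$, the open cylinder $C(\mathbf{x},\varepsilon,i)$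 with constraining coordinate $i$ is $\{\mathbf{z}\in X_{\mathcal{P}}:|z_0-x_0|<\varepsilon\}$ if $i=0$ and $\{\mathbf{z}\in X_{\mathcal{P}}:|z_i-x_i|_{p_i}<p_i\varepsilon\}$ if $i>0$. Its radius is $\varepsilon$ if $i=0$, and the infimum of all $\varepsilon'>0$ with $C(\mathbf{x},\varepsilon',i)=C(\mathbf{x},\varepsilon,i)$ if $i>0$. Game. Let $F\subset X_{\mathcal{P}}$ and $0<\beta<1$. In the cylinder $\beta$-absolute game Bob first chooses a closed ball $B_0$. For $j\ge1$, given $B_{j-1}$, Alice chooses an open cylinder $C_j$ of radius at most $\beta\cdot\mathrm{radius}(B_{j-1})$, and then Bob chooses a closed ball $B_j\subset B_{j-1}\setminus C_j$ with $\mathrm{radius}(B_j)\ge\beta\cdot\mathrm{radius}(B_{j-1})$. If at some finite stage Bob has no legal choice, Bob wins; otherwise Alice wins iff $\bigcap_j B_j\cap F\ne\emptyset$. $F$ is cylinder $\beta$-absolute winning if Alice has a winning strategy. $F$ is cylinder absolute winning (CAW) if there is $0<\beta_{\mathcal{P}}(F)\le1/3$ such that $F$ is cylinder $\beta$-absolute winning for all $\beta\in(0,\beta_{\mathcal{P}}(F))$. A subset $F\subset\Sigma_{\mathcal{P}}$ is called CAW if $\Pi^{-1}(F)$ is CAW in $X_{\mathcal{P}}$. *)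

theory Defs
  imports "HOL-Analysis.Analysis" "HOL-Algebra.QuotRing" "HOL-Algebra.Generated_Rings" "HOL-Computational_Algebra.Primes"
begin

section \<open>The field of p-adic numbers\<close>

definition padic_abs_rat :: "nat \<Rightarrow> rat \<Rightarrow> real" where
  "padic_abs_rat p x =
     (if x = 0 then 0
      else real p powi (int (multiplicity (int p) (snd (quotient_of x)))
                        - int (multiplicity (int p) (fst (quotient_of x)))))"

definition cauchy_ring :: "nat \<Rightarrow> (nat \<Rightarrow> rat) ring" where
  "cauchy_ring p =
     \<lparr>carrier = {X. Metric_space.MCauchy UNIV (\<lambda>x y. padic_abs_rat p (x - y)) X},
      mult = (\<lambda>X Y n. X n * Y n), one = (\<lambda>_. 1),
      zero = (\<lambda>_. 0), add = (\<lambda>X Y n. X n + Y n)\<rparr>"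

definition null_ideal :: "nat \<Rightarrow> (nat \<Rightarrow> rat) set" where
  "null_ideal p = {X. (\<lambda>n. padic_abs_rat p (X n)) \<longlonglongrightarrow> 0}"

type_synonym padic = "(nat \<Rightarrow> rat) set"

text \<open>The completion of the rationals for the p-adic absolute value: Cauchy sequences modulo
  null sequences. As p varies in the statement, the fields are carrier sets in one type.\<close>

definition Qp :: "nat \<Rightarrow> padic ring" where
  "Qp p = cauchy_ring p Quot null_ideal p"

definition padic_of_rat :: "nat \<Rightarrow> rat \<Rightarrow> padic" where
  "padic_of_rat p r = null_ideal p +>\<^bsub>cauchy_ring p\<^esub> (\<lambda>_. r)"

definition padic_abs :: "nat \<Rightarrow> padic \<Rightarrow> real" where
  "padic_abs p u = (THE r. \<forall>X\<in>u. (\<lambda>n. padic_abs_rat p (X n)) \<longlonglongrightarrow> r)"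

definition Zp :: "nat \<Rightarrow> padic set" where
  "Zp p = {u \<in> carrier (Qp p). padic_abs p u \<le> 1}"


section \<open>The restricted product\<close>

text \<open>A point is a pair of its real coordinate and the family of its p-adic coordinates, which is
  indexed by the primes themselves and is \<^const>\<open>undefined\<close> off \<open>P\<close>.\<close>

type_synonym cover_pt = "real \<times> (nat \<Rightarrow> padic)"

definition cover :: "nat set \<Rightarrow> cover_pt ring" where
  "cover P =
     \<lparr>carrier = {x. snd x \<in> (\<Pi>\<^sub>E p\<in>P. carrier (Qp p)) \<and> finite {p\<in>P. snd x p \<notin> Zp p}},
      mult = (\<lambda>x y. (fst x * fst y, \<lambda>p\<in>P. snd x p \<otimes>\<^bsub>Qp p\<^esub> snd y p)),
      one = (1, \<lambda>p\<in>P. \<one>\<^bsub>Qp p\<^esub>),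
      zero = (0, \<lambda>p\<in>P. \<zero>\<^bsub>Qp p\<^esub>),
      add = (\<lambda>x y. (fst x + fst y, \<lambda>p\<in>P. snd x p \<oplus>\<^bsub>Qp p\<^esub> snd y p))\<rparr>"

text \<open>Taking one supremum over all coordinates, the real one included, avoids the supremum of the
  empty set when \<open>P\<close> is empty; on the carrier the set is bounded, since almost all p-adic terms are
  at most \<open>1 / p\<close>. The locale \<^locale>\<open>Metric_space\<close> asks for symmetry and nonnegativity off the
  carrier too, whence the value \<open>0\<close> there.\<close>

definition cover_dist :: "nat set \<Rightarrow> cover_pt \<Rightarrow> cover_pt \<Rightarrow> real" where
  "cover_dist P x z =
     (if x \<in> carrier (cover P) \<and> z \<in> carrier (cover P)
      then Sup (insert \<bar>fst x - fst z\<bar>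
                  ((\<lambda>p. padic_abs p (snd x p \<ominus>\<^bsub>Qp p\<^esub> snd z p) / real p) ` P))
      else 0)"

abbreviation cover_topology :: "nat set \<Rightarrow> cover_pt topology" where
  "cover_topology P \<equiv> Metric_space.mtopology (carrier (cover P)) (cover_dist P)"

abbreviation cover_cball :: "nat set \<Rightarrow> cover_pt \<Rightarrow> real \<Rightarrow> cover_pt set" where
  "cover_cball P \<equiv> Metric_space.mcball (carrier (cover P)) (cover_dist P)"


section \<open>The solenoid\<close>

definition rat_ring :: "rat ring" where
  "rat_ring = \<lparr>carrier = UNIV, mult = (*), one = 1, zero = 0, add = (+)\<rparr>"

definition invert_primes :: "nat set \<Rightarrow> rat set" where
  "invert_primes P = generate_ring rat_ring ((\<lambda>p. 1 / of_nat p) ` P)"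

definition diag :: "nat set \<Rightarrow> rat \<Rightarrow> cover_pt" where
  "diag P r = (of_rat r, \<lambda>p\<in>P. padic_of_rat p r)"

definition diag_lattice :: "nat set \<Rightarrow> cover_pt set" where
  "diag_lattice P = diag P ` invert_primes P"

type_synonym solenoid_pt = "cover_pt set"

text \<open>The quotient group is written multiplicatively by the library: its operation
  \<open>\<otimes>\<close> is the addition of cosets and \<open>\<one>\<close> is the neutral element \<open>0\<close> of the solenoid.\<close>

definition solenoid :: "nat set \<Rightarrow> solenoid_pt monoid" where
  "solenoid P = cover P A_Mod diag_lattice P"

definition solenoid_proj :: "nat set \<Rightarrow> cover_pt \<Rightarrow> solenoid_pt" where
  "solenoid_proj P x = diag_lattice P +>\<^bsub>cover P\<^esub> x"

definition solenoid_preimage :: "nat set \<Rightarrow> solenoid_pt set \<Rightarrow> cover_pt set" where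
  "solenoid_preimage P F = {x \<in> carrier (cover P). solenoid_proj P x \<in> F}"

definition solenoid_topology :: "nat set \<Rightarrow> solenoid_pt topology" where
  "solenoid_topology P = topology (\<lambda>U. U \<subseteq> carrier (solenoid P) \<and>
     openin (cover_topology P) (solenoid_preimage P U))"

text \<open>Componentwise multiplication by \<open>r\<close>, performed on the representatives of a coset. For
  \<open>r \<in> invert_primes P\<close> the diagonal copy of \<open>invert_primes P\<close> is stable under \<open>r\<close>, so all
  members of the union coincide, as for \<^const>\<open>rcoset_mult\<close>.\<close>

definition solenoid_smult :: "nat set \<Rightarrow> rat \<Rightarrow> solenoid_pt \<Rightarrow> solenoid_pt" where
  "solenoid_smult P r y = (\<Union>x\<in>y. solenoid_proj P (diag P r \<otimes>\<^bsub>cover P\<^esub> x))"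

definition affine_map :: "nat set \<Rightarrow> rat \<Rightarrow> solenoid_pt \<Rightarrow> solenoid_pt \<Rightarrow> solenoid_pt" where
  "affine_map P r a x = solenoid_smult P r x \<otimes>\<^bsub>solenoid P\<^esub> a"

definition periodic_orbit :: "nat set \<Rightarrow> rat \<Rightarrow> solenoid_pt set \<Rightarrow> bool" where
  "periodic_orbit P B S \<longleftrightarrow>
     (\<exists>y\<in>carrier (solenoid P). (\<exists>q\<ge>1. solenoid_smult P (B ^ q) y = y) \<and>
        S = {solenoid_smult P (B ^ k) y | k. k \<ge> 0})"


section \<open>The cylinder absolute game\<close>

text \<open>The constraining coordinate is \<open>0\<close> for the real coordinate and otherwise a prime of \<open>P\<close>.\<close>

definition cylinder :: "nat set \<Rightarrow> cover_pt \<Rightarrow> real \<Rightarrow> nat \<Rightarrow> cover_pt set" where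
  "cylinder P x e i =
     {z \<in> carrier (cover P).
        if i = 0 then \<bar>fst z - fst x\<bar> < e
        else padic_abs i (snd z i \<ominus>\<^bsub>Qp i\<^esub> snd x i) < real i * e}"

definition cylinder_radius :: "nat set \<Rightarrow> cover_pt \<Rightarrow> real \<Rightarrow> nat \<Rightarrow> real" where
  "cylinder_radius P x e i =
     (if i = 0 then e else Inf {e'. e' > 0 \<and> cylinder P x e' i = cylinder P x e i})"

definition closed_ball :: "nat set \<Rightarrow> cover_pt set \<Rightarrow> bool" where
  "closed_ball P B \<longleftrightarrow> (\<exists>x\<in>carrier (cover P). \<exists>r>0. B = cover_cball P x r)"

text \<open>The radius is determined by the set, because the projection of the ball to the real
  coordinate is an interval of length \<open>2 * r\<close>.\<close>

definition ball_radius :: "nat set \<Rightarrow> cover_pt set \<Rightarrow> real" where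
  "ball_radius P B = (THE r. r > 0 \<and> (\<exists>x\<in>carrier (cover P). B = cover_cball P x r))"

definition alice_legal :: "nat set \<Rightarrow> real \<Rightarrow> cover_pt set \<Rightarrow> cover_pt set \<Rightarrow> bool" where
  "alice_legal P \<beta> B C \<longleftrightarrow>
     (\<exists>x\<in>carrier (cover P). \<exists>e>0. \<exists>i\<in>insert 0 P.
        C = cylinder P x e i \<and> cylinder_radius P x e i \<le> \<beta> * ball_radius P B)"

definition bob_legal ::
    "nat set \<Rightarrow> real \<Rightarrow> cover_pt set \<Rightarrow> cover_pt set \<Rightarrow> cover_pt set \<Rightarrow> bool" where
  "bob_legal P \<beta> B C B' \<longleftrightarrow>
     closed_ball P B' \<and> B' \<subseteq> B - C \<and> ball_radius P B' \<ge> \<beta> * ball_radius P B"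

text \<open>A strategy of Alice maps the nonempty list \<open>[B\<^sub>0, \<dots>, B\<^sub>n]\<close> of Bob's moves so far to the
  cylinder she chooses next.\<close>

type_synonym strategy = "cover_pt set list \<Rightarrow> cover_pt set"

definition bob_history :: "nat set \<Rightarrow> real \<Rightarrow> strategy \<Rightarrow> cover_pt set list \<Rightarrow> bool" where
  "bob_history P \<beta> \<sigma> Bs \<longleftrightarrow>
     Bs \<noteq> [] \<and> closed_ball P (Bs ! 0) \<and>
     (\<forall>j. Suc j < length Bs \<longrightarrow> bob_legal P \<beta> (Bs ! j) (\<sigma> (take (Suc j) Bs)) (Bs ! Suc j))"

text \<open>The first conjunct says that Alice always moves legally and that Bob is never stuck, since
  he wins if he has no legal choice.\<close>

definition winning_strategy :: "nat set \<Rightarrow> real \<Rightarrow> cover_pt set \<Rightarrow> strategy \<Rightarrow> bool" where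
  "winning_strategy P \<beta> F \<sigma> \<longleftrightarrow>
     (\<forall>Bs. bob_history P \<beta> \<sigma> Bs \<longrightarrow>
        alice_legal P \<beta> (last Bs) (\<sigma> Bs) \<and> (\<exists>B'. bob_legal P \<beta> (last Bs) (\<sigma> Bs) B')) \<and>
     (\<forall>B :: nat \<Rightarrow> cover_pt set.
        (\<forall>j. bob_history P \<beta> \<sigma> (map B [0..<Suc j])) \<longrightarrow> (\<Inter>j. B j) \<inter> F \<noteq> {})"

definition cylinder_absolute_winning :: "nat set \<Rightarrow> cover_pt set \<Rightarrow> bool" where
  "cylinder_absolute_winning P F \<longleftrightarrow>
     F \<subseteq> carrier (cover P) \<and>
     (\<exists>\<beta>0. 0 < \<beta>0 \<and> \<beta>0 \<le> 1/3 \<and>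
        (\<forall>\<beta>. 0 < \<beta> \<and> \<beta> < \<beta>0 \<longrightarrow> (\<exists>\<sigma>. winning_strategy P \<beta> F \<sigma>)))"

definition solenoid_CAW :: "nat set \<Rightarrow> solenoid_pt set \<Rightarrow> bool" where
  "solenoid_CAW P F \<longleftrightarrow>
     F \<subseteq> carrier (solenoid P) \<and> cylinder_absolute_winning P (solenoid_preimage P F)"

end

(* An orbit closure that contains a periodic B-orbit contains a rational point, the image of
   diag t with t rational, since (B^q - 1) x lies in the lattice. So it suffices that Alice keeps,
   for each of the countably many pairs (j, t), the orbit of A_j at a positive distance from that
   point.
   If m_j/n_j is not 1 or -1, some place, real or in the finite set of condition (2), is expanded
   most, by a factor greater than 1. At the time scale where A_j^k blows the current ball up to
   a small fixed size, the points of the ball whose orbit comes near the target all lie in one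
   cylinder at that place: two such visits, at times k <= k', force A_j^(k'-k) to map the target
   exactly to itself, because the lattice is discrete. Alice can postpone this move by any bounded
   number of turns, at the price of a smaller distance, and so serves all pairs (j, t) in turn.
   If m_j/n_j is 1 or -1, then A_j is an involution and only countably many points must be
   avoided. *)

theory Submission
  imports Defs
begin


section \<open>The p-adic absolute value of a rational number\<close>

text \<open>One bound on \<open>\<beta>\<close> has to serve all maps at once. A cylinder at a prime
  \<open>q\<close> can swallow Bob's whole ball when \<open>\<beta>\<close> times \<open>q\<close>
  exceeds 1, because q-adic distances jump by factors of \<open>q\<close>. Condition (2) confines
  Alice's moves to the real place and a finite set \<open>Q\<close>, so the bound depends on
  \<open>Q\<close> alone. Two further obstacles shape the strategy. Bob need not shrink his balls,
  although the argument needs radii tending to 0; Alice therefore spends every second turn on a real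
  cylinder that halves the radius. And infinitely many tasks share the other turns, so each needs
  bounded gaps between its own turns: the tasks are dealt out by the exponent of 2 in the turn
  number, and \<open>manageable\<close> asks that a task can be done for any given bound on the
  shrinking between its turns. Closeness in the solenoid is measured upstairs, as distance to the
  whole fibre of a rational point. The fibre is infinite, but lattice translations carry any
  statement about one of its points to all of them, which yields the uniform separation
  constants.\<close>

lemma padic_abs_rat_0 [simp]: "padic_abs_rat p 0 = 0"
  by (simp add: padic_abs_rat_def)

lemma padic_abs_rat_nonneg [simp]: "0 \<le> padic_abs_rat p x"
  by (simp add: padic_abs_rat_def)

lemma padic_abs_rat_pos: "prime p \<Longrightarrow> x \<noteq> 0 \<Longrightarrow> 0 < padic_abs_rat p x"
  by (simp add: padic_abs_rat_def prime_gt_0_nat)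

text \<open>Cross-multiplying shows that the difference of multiplicities does not depend on the
  chosen fraction. This frees later arguments from the reduced form in the definition, so that
  products and common denominators can be used directly.\<close>

lemma padic_abs_rat_divide_of_int:
  assumes p: "prime p" and a: "a \<noteq> 0" and b: "b \<noteq> 0"
  shows "padic_abs_rat p (of_int a / of_int b) =
    real p powi (int (multiplicity (int p) b) - int (multiplicity (int p) a))"
proof -
  obtain c d where q: "quotient_of (of_int a / of_int b) = (c, d)"
    by (cases "quotient_of (of_int a / of_int b :: rat)")
  have d: "d > 0" using quotient_of_denom_pos[OF q] .
  have eq: "(of_int a / of_int b :: rat) = of_int c / of_int d" using quotient_of_div[OF q] .
  then have "rat_of_int (a * d) = rat_of_int (c * b)" using b d by (simp add: field_simps)
  then have e: "a * d = c * b" by linarith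
  then have c: "c \<noteq> 0" using a d by auto
  have pe: "prime_elem (int p)" using p by simp
  have "multiplicity (int p) a + multiplicity (int p) d = multiplicity (int p) c + multiplicity (int p) b"
    using prime_elem_multiplicity_mult_distrib[OF pe] a b c d e by (metis less_irrefl)
  then have "int (multiplicity (int p) d) - int (multiplicity (int p) c) =
      int (multiplicity (int p) b) - int (multiplicity (int p) a)" by linarith
  then show ?thesis using q a b by (simp add: padic_abs_rat_def)
qed

lemma rat_frac_cases:
  fixes x :: rat
  obtains a b where "b \<noteq> 0" "x = of_int a / of_int b"
  by (metis quotient_of_div quotient_of_denom_pos less_irrefl surj_pair)

lemma padic_abs_rat_mult:
  assumes p: "prime p"
  shows "padic_abs_rat p (x * y) = padic_abs_rat p x * padic_abs_rat p y"
proof (cases "x = 0 \<or> y = 0")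
  case False
  obtain a b where x: "b \<noteq> 0" "x = of_int a / of_int b" by (rule rat_frac_cases)
  obtain c d where y: "d \<noteq> 0" "y = of_int c / of_int d" by (rule rat_frac_cases)
  have a: "a \<noteq> 0" "c \<noteq> 0" using False x y by auto
  have pe: "prime_elem (int p)" using p by simp
  have "x * y = of_int (a * c) / of_int (b * d)" using x y by simp
  then show ?thesis using x y a p
    by (simp only: padic_abs_rat_divide_of_int mult_eq_0_iff simp_thms
        prime_elem_multiplicity_mult_distrib[OF pe] of_nat_add
        power_int_add[symmetric] of_nat_eq_0_iff prime_gt_0_nat not_gr_zero[symmetric])
      (simp add: power_int_add[symmetric] prime_gt_0_nat algebra_simps)
qed auto

lemma padic_abs_rat_minus [simp]: "padic_abs_rat p (- x) = padic_abs_rat p x"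
proof -
  obtain c d where "quotient_of x = (c, d)" by (cases "quotient_of x")
  then show ?thesis
    using multiplicity_times_unit_right[of "-1" "int p" c]
    by (auto simp: padic_abs_rat_def rat_uminus_code)
qed

lemma padic_abs_rat_1 [simp]: "padic_abs_rat p 1 = 1"
  by (simp add: padic_abs_rat_def)

lemma padic_abs_rat_minus_commute: "padic_abs_rat p (x - y) = padic_abs_rat p (y - x)"
  using padic_abs_rat_minus[of p "x - y"] by simp

text \<open>Over a common denominator only the numerators matter, and a power of \<open>p\<close>
  that divides both of them divides their sum.\<close>

lemma padic_abs_rat_ultrametric:
  assumes p: "prime p"
  shows "padic_abs_rat p (x + y) \<le> max (padic_abs_rat p x) (padic_abs_rat p y)"
proof (cases "x = 0 \<or> y = 0 \<or> x + y = 0")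
  case False
  have p1: "real p > 1" using prime_gt_1_nat[OF p] by simp
  obtain a b where x: "b \<noteq> 0" "x = of_int a / of_int b" by (rule rat_frac_cases)
  obtain c d where y: "d \<noteq> 0" "y = of_int c / of_int d" by (rule rat_frac_cases)
  define A C E where "A = a * d" and "C = c * b" and "E = b * d"
  have nz: "A \<noteq> 0" "C \<noteq> 0" "E \<noteq> 0" using False x y by (auto simp: A_def C_def E_def)
  have xE: "x = of_int A / of_int E" and yE: "y = of_int C / of_int E"
    using x y by (simp_all add: A_def C_def E_def)
  then have sE: "x + y = of_int (A + C) / of_int E" by (simp add: add_divide_distrib)
  have AC: "A + C \<noteq> 0" using False sE by auto
  have "\<not> is_unit (int p)" using prime_gt_1_nat[OF p] by (simp add: zdvd1_eq)
  have "int p ^ k dvd A + C" if "k = min (multiplicity (int p) A) (multiplicity (int p) C)" for k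
    using that by (intro dvd_add multiplicity_dvd') simp_all
  then have "min (multiplicity (int p) A) (multiplicity (int p) C) \<le> multiplicity (int p) (A + C)"
    using AC \<open>\<not> is_unit (int p)\<close> by (intro multiplicity_geI) simp_all
  then consider "multiplicity (int p) A \<le> multiplicity (int p) (A + C)"
    | "multiplicity (int p) C \<le> multiplicity (int p) (A + C)" by linarith
  then show ?thesis
  proof cases
    case 1
    then have "padic_abs_rat p (x + y) \<le> padic_abs_rat p x"
      unfolding sE unfolding xE
      using padic_abs_rat_divide_of_int[OF p AC nz(3)] padic_abs_rat_divide_of_int[OF p nz(1) nz(3)] p1
      by (simp add: power_int_increasing)
    then show ?thesis by simp
  next
    case 2
    then have "padic_abs_rat p (x + y) \<le> padic_abs_rat p y"
      unfolding sE unfolding yE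
      using padic_abs_rat_divide_of_int[OF p AC nz(3)] padic_abs_rat_divide_of_int[OF p nz(2) nz(3)] p1
      by (simp add: power_int_increasing)
    then show ?thesis by simp
  qed
qed (auto simp: le_max_iff_disj)

lemma padic_abs_rat_add_le:
  assumes "prime p" "padic_abs_rat p x \<le> c" "padic_abs_rat p y \<le> c"
  shows "padic_abs_rat p (x + y) \<le> c"
  using padic_abs_rat_ultrametric[OF assms(1), of x y] assms by linarith

lemma padic_abs_rat_diff_ultrametric:
  assumes "prime p"
  shows "padic_abs_rat p (x - y) \<le> max (padic_abs_rat p x) (padic_abs_rat p y)"
  using padic_abs_rat_ultrametric[OF assms, of x "- y"] by simp

lemma padic_abs_rat_triangle_sub:
  assumes "prime p"
  shows "\<bar>padic_abs_rat p x - padic_abs_rat p y\<bar> \<le> padic_abs_rat p (x - y)"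
proof -
  have "padic_abs_rat p x \<le> max (padic_abs_rat p (x - y)) (padic_abs_rat p y)"
    using padic_abs_rat_ultrametric[OF assms, of "x - y" y] by simp
  moreover have "padic_abs_rat p y \<le> max (padic_abs_rat p (x - y)) (padic_abs_rat p x)"
    using padic_abs_rat_ultrametric[OF assms, of "y - x" x]
    by (simp add: padic_abs_rat_minus_commute[of p y x])
  ultimately show ?thesis using padic_abs_rat_nonneg[of p] by (smt (verit))
qed

lemma padic_abs_rat_power_self:
  assumes "prime p"
  shows "padic_abs_rat p (of_nat p powi k) = real p powi (- k)"
proof -
  have pe: "prime_elem (int p)" using assms by simp
  have p0: "int p ^ n \<noteq> 0" for n using prime_gt_0_nat[OF assms] by simp
  have "padic_abs_rat p (of_nat p ^ n) = real p powi (- int n)" for n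
    using padic_abs_rat_divide_of_int[OF assms p0[of n], of 1] pe by simp
  moreover have "padic_abs_rat p (inverse (of_nat p ^ n)) = real p powi (int n)" for n
    using padic_abs_rat_divide_of_int[OF assms _ p0[of n], of 1] pe by (simp add: field_simps)
  ultimately show ?thesis
    by (cases k rule: int_cases4) (auto simp: power_int_minus)
qed

text \<open>The nonzero values are integer powers of \<open>p\<close>, so none lies strictly between
  1 and \<open>p\<close>. This gap later shows that a limit in the cover is integral at almost all
  primes.\<close>

lemma padic_abs_rat_lt_self:
  assumes p: "prime p" and x: "padic_abs_rat p x < real p"
  shows "padic_abs_rat p x \<le> 1"
proof (cases "x = 0")
  case False
  have p1: "real p > 1" using prime_gt_1_nat[OF p] by simp
  define k where "k = int (multiplicity (int p) (snd (quotient_of x)))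
                        - int (multiplicity (int p) (fst (quotient_of x)))"
  have e: "padic_abs_rat p x = real p powi k" using False by (simp add: padic_abs_rat_def k_def)
  have "k \<le> 0"
  proof (rule ccontr)
    assume "\<not> k \<le> 0"
    then have "real p powi 1 \<le> real p powi k" using p1 by (intro power_int_increasing) auto
    then show False using x e by simp
  qed
  then have "real p powi k \<le> real p powi 0" using p1 by (intro power_int_increasing) auto
  then show ?thesis using e by simp
qed simp

section \<open>The field of p-adic numbers\<close>

text \<open>The condition of \<open>MCauchy\<close> spelled out. The library characterisation is
  available only after the metric axioms, hence only for prime \<open>p\<close>.\<close>

definition padic_cauchy :: "nat \<Rightarrow> (nat \<Rightarrow> rat) set" where
  "padic_cauchy p = {X. \<forall>e>0. \<exists>N. \<forall>m\<ge>N. \<forall>n\<ge>N. padic_abs_rat p (X m - X n) < e}"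

lemma Metric_space_padic_abs_rat:
  assumes "prime p"
  shows "Metric_space UNIV (\<lambda>x y. padic_abs_rat p (x - y))"
proof
  fix x y z :: rat
  show "0 \<le> padic_abs_rat p (x - y)" by simp
  show "padic_abs_rat p (x - y) = padic_abs_rat p (y - x)" by (rule padic_abs_rat_minus_commute)
  show "(padic_abs_rat p (x - y) = 0) = (x = y)"
    using padic_abs_rat_pos[OF assms, of "x - y"] by fastforce
  show "padic_abs_rat p (x - z) \<le> padic_abs_rat p (x - y) + padic_abs_rat p (y - z)"
    using padic_abs_rat_ultrametric[OF assms, of "x - y" "y - z"]
      padic_abs_rat_nonneg[of p "x - y"] padic_abs_rat_nonneg[of p "y - z"]
    by (simp del: padic_abs_rat_nonneg)
qed

lemma carrier_cauchy_ring:
  assumes "prime p"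
  shows "carrier (cauchy_ring p) = padic_cauchy p"
  using Metric_space.MCauchy_def[OF Metric_space_padic_abs_rat[OF assms]]
  by (fastforce simp: cauchy_ring_def padic_cauchy_def)

lemma padic_cauchyD:
  "X \<in> padic_cauchy p \<Longrightarrow> e > 0 \<Longrightarrow> \<exists>N. \<forall>m\<ge>N. \<forall>n\<ge>N. padic_abs_rat p (X m - X n) < e"
  by (simp add: padic_cauchy_def)

lemma padic_cauchy_const [simp]: "(\<lambda>_. c) \<in> padic_cauchy p"
  by (simp add: padic_cauchy_def)

lemma padic_cauchy_add:
  assumes p: "prime p" and "X \<in> padic_cauchy p" "Y \<in> padic_cauchy p"
  shows "(\<lambda>n. X n + Y n) \<in> padic_cauchy p"
  unfolding padic_cauchy_def mem_Collect_eq
proof (intro allI impI)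
  fix e :: real assume e: "e > 0"
  obtain N where N: "\<forall>m\<ge>N. \<forall>n\<ge>N. padic_abs_rat p (X m - X n) < e"
    using assms e by (auto simp: padic_cauchy_def)
  obtain M where M: "\<forall>m\<ge>M. \<forall>n\<ge>M. padic_abs_rat p (Y m - Y n) < e"
    using assms e by (auto simp: padic_cauchy_def)
  have "padic_abs_rat p (X m + Y m - (X n + Y n)) < e" if "m \<ge> max N M" "n \<ge> max N M" for m n
  proof -
    have "X m + Y m - (X n + Y n) = (X m - X n) + (Y m - Y n)" by simp
    then show ?thesis
      using padic_abs_rat_ultrametric[OF p, of "X m - X n" "Y m - Y n"] N M that
      by (smt (verit) max.bounded_iff)
  qed
  then show "\<exists>N. \<forall>m\<ge>N. \<forall>n\<ge>N. padic_abs_rat p (X m + Y m - (X n + Y n)) < e" by blast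
qed

lemma padic_cauchy_bounded:
  assumes p: "prime p" and "X \<in> padic_cauchy p"
  obtains c where "c > 0" "\<And>n. padic_abs_rat p (X n) \<le> c"
proof -
  obtain N where N: "\<forall>m\<ge>N. \<forall>n\<ge>N. padic_abs_rat p (X m - X n) < 1"
    using assms zero_less_one by (fastforce simp: padic_cauchy_def)
  define c where "c = Max (insert 1 ((\<lambda>n. padic_abs_rat p (X n)) ` {..N}))"
  have c1: "c \<ge> 1" by (simp add: c_def)
  have cN: "padic_abs_rat p (X n) \<le> c" if "n \<le> N" for n
    unfolding c_def using that by (intro Max_ge) auto
  have "padic_abs_rat p (X n) \<le> c" for n
  proof (cases "n \<le> N")
    case False
    then have "padic_abs_rat p (X n - X N) \<le> c" using N c1 by (smt (verit) le_refl nat_le_linear)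
    then show ?thesis using padic_abs_rat_add_le[OF p _ cN[of N], of "X n - X N"] by simp
  qed (rule cN)
  then show ?thesis using c1 that[of c] by simp
qed

lemma padic_cauchy_mult:
  assumes p: "prime p" and X: "X \<in> padic_cauchy p" and Y: "Y \<in> padic_cauchy p"
  shows "(\<lambda>n. X n * Y n) \<in> padic_cauchy p"
  unfolding padic_cauchy_def mem_Collect_eq
proof (intro allI impI)
  fix e :: real assume e: "e > 0"
  obtain c where c: "c > 0" "\<And>n. padic_abs_rat p (X n) \<le> c" using padic_cauchy_bounded[OF p X] by blast
  obtain d where d: "d > 0" "\<And>n. padic_abs_rat p (Y n) \<le> d" using padic_cauchy_bounded[OF p Y] by blast
  obtain N where N: "\<forall>m\<ge>N. \<forall>n\<ge>N. padic_abs_rat p (X m - X n) < e / d"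
    using padic_cauchyD[OF X, of "e / d"] e d by auto
  obtain M where M: "\<forall>m\<ge>M. \<forall>n\<ge>M. padic_abs_rat p (Y m - Y n) < e / c"
    using padic_cauchyD[OF Y, of "e / c"] e c by auto
  have "padic_abs_rat p (X m * Y m - X n * Y n) < e" if "m \<ge> max N M" "n \<ge> max N M" for m n
  proof -
    have eq: "X m * Y m - X n * Y n = X m * (Y m - Y n) + (X m - X n) * Y n"
      by (simp add: algebra_simps)
    have "padic_abs_rat p (X m * (Y m - Y n)) \<le> c * padic_abs_rat p (Y m - Y n)"
      using c by (simp add: padic_abs_rat_mult[OF p] mult_right_mono)
    also have "\<dots> < c * (e / c)" using M that c by (intro mult_strict_left_mono) auto
    finally have 1: "padic_abs_rat p (X m * (Y m - Y n)) < e" using c by simp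
    have "padic_abs_rat p ((X m - X n) * Y n) \<le> padic_abs_rat p (X m - X n) * d"
      using d by (simp add: padic_abs_rat_mult[OF p] mult_left_mono)
    also have "\<dots> < (e / d) * d" using N that d by (intro mult_strict_right_mono) auto
    finally have 2: "padic_abs_rat p ((X m - X n) * Y n) < e" using d by simp
    show ?thesis unfolding eq
      using padic_abs_rat_ultrametric[OF p, of "X m * (Y m - Y n)" "(X m - X n) * Y n"] 1 2
      by linarith
  qed
  then show "\<exists>N. \<forall>m\<ge>N. \<forall>n\<ge>N. padic_abs_rat p (X m * Y m - X n * Y n) < e" by blast
qed

lemma padic_cauchy_minus:
  assumes "X \<in> padic_cauchy p" shows "(\<lambda>n. - X n) \<in> padic_cauchy p"
proof -
  have "padic_abs_rat p (- X m - - X n) = padic_abs_rat p (X m - X n)" for m n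
    using padic_abs_rat_minus_commute[of p "X m" "X n"] by simp
  then show ?thesis using assms by (simp add: padic_cauchy_def)
qed

lemma cauchy_ring_simps:
  "mult (cauchy_ring p) = (\<lambda>X Y n. X n * Y n)"
  "one (cauchy_ring p) = (\<lambda>_. 1)"
  "zero (cauchy_ring p) = (\<lambda>_. 0)"
  "add (cauchy_ring p) = (\<lambda>X Y n. X n + Y n)"
  by (simp_all add: cauchy_ring_def)

lemma cring_cauchy_ring:
  assumes p: "prime p"
  shows "cring (cauchy_ring p)"
proof (rule cringI)
  note car = carrier_cauchy_ring[OF p]
  show "abelian_group (cauchy_ring p)"
  proof (rule abelian_groupI)
    fix X assume "X \<in> carrier (cauchy_ring p)"
    then show "\<exists>Y\<in>carrier (cauchy_ring p). Y \<oplus>\<^bsub>cauchy_ring p\<^esub> X = \<zero>\<^bsub>cauchy_ring p\<^esub>"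
      using padic_cauchy_minus[of X p]
      by (intro bexI[of _ "\<lambda>n. - X n"]) (simp_all add: car cauchy_ring_simps)
  qed (simp_all add: car cauchy_ring_simps padic_cauchy_add[OF p] algebra_simps)
  show "comm_monoid (cauchy_ring p)"
    by (rule comm_monoidI) (simp_all add: car cauchy_ring_simps padic_cauchy_mult[OF p] algebra_simps)
qed (simp add: cauchy_ring_simps algebra_simps)

lemma null_ideal_subset_padic_cauchy:
  assumes p: "prime p"
  shows "null_ideal p \<subseteq> padic_cauchy p"
proof
  fix X assume X: "X \<in> null_ideal p"
  show "X \<in> padic_cauchy p"
    unfolding padic_cauchy_def mem_Collect_eq
  proof (intro allI impI)
    fix e :: real assume "e > 0"
    then have "\<forall>\<^sub>F n in sequentially. padic_abs_rat p (X n) < e"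
      using X order_tendstoD(2) by (auto simp: null_ideal_def)
    then obtain N where "\<forall>n\<ge>N. padic_abs_rat p (X n) < e"
      by (auto simp: eventually_sequentially)
    then show "\<exists>N. \<forall>m\<ge>N. \<forall>n\<ge>N. padic_abs_rat p (X m - X n) < e"
      using padic_abs_rat_diff_ultrametric[OF p] by (metis (no_types, lifting) le_less_trans max_less_iff_conj)
  qed
qed

lemma null_ideal_add:
  assumes p: "prime p" and "X \<in> null_ideal p" "Y \<in> null_ideal p"
  shows "(\<lambda>n. X n + Y n) \<in> null_ideal p"
proof -
  have "(\<lambda>n. max (padic_abs_rat p (X n)) (padic_abs_rat p (Y n))) \<longlonglongrightarrow> max 0 0"
    using assms by (intro tendsto_max) (auto simp: null_ideal_def)
  then have "(\<lambda>n. max (padic_abs_rat p (X n)) (padic_abs_rat p (Y n))) \<longlonglongrightarrow> 0" by simp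
  then have "(\<lambda>n. padic_abs_rat p (X n + Y n)) \<longlonglongrightarrow> 0"
    by (rule Lim_null_comparison[rotated]) (simp add: padic_abs_rat_ultrametric[OF p])
  then show ?thesis by (simp add: null_ideal_def)
qed

lemma null_ideal_mult:
  assumes p: "prime p" and "X \<in> null_ideal p" and Y: "Y \<in> padic_cauchy p"
  shows "(\<lambda>n. X n * Y n) \<in> null_ideal p"
proof -
  obtain c where c: "c > 0" "\<And>n. padic_abs_rat p (Y n) \<le> c" using padic_cauchy_bounded[OF p Y] by blast
  have "(\<lambda>n. padic_abs_rat p (X n) * c) \<longlonglongrightarrow> 0 * c"
    using assms by (intro tendsto_mult tendsto_const) (auto simp: null_ideal_def)
  then have "(\<lambda>n. padic_abs_rat p (X n) * c) \<longlonglongrightarrow> 0" by simp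
  then have "(\<lambda>n. padic_abs_rat p (X n * Y n)) \<longlonglongrightarrow> 0"
    by (rule Lim_null_comparison[rotated]) (simp add: padic_abs_rat_mult[OF p] c mult_left_mono)
  then show ?thesis by (simp add: null_ideal_def)
qed

lemma null_ideal_minus: "X \<in> null_ideal p \<Longrightarrow> (\<lambda>n. - X n) \<in> null_ideal p"
  by (simp add: null_ideal_def)

lemma zero_in_null_ideal [simp]: "(\<lambda>_. 0) \<in> null_ideal p"
  by (simp add: null_ideal_def)

lemma a_inv_cauchy_ring:
  assumes p: "prime p" and X: "X \<in> padic_cauchy p"
  shows "\<ominus>\<^bsub>cauchy_ring p\<^esub> X = (\<lambda>n. - X n)"
proof -
  interpret cring "cauchy_ring p" by (rule cring_cauchy_ring[OF p])
  show ?thesis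
    using X padic_cauchy_minus[OF X]
    by (intro minus_equality) (auto simp: carrier_cauchy_ring[OF p] cauchy_ring_simps)
qed

lemma ideal_null_ideal:
  assumes p: "prime p"
  shows "ideal (null_ideal p) (cauchy_ring p)"
proof -
  interpret cring "cauchy_ring p" by (rule cring_cauchy_ring[OF p])
  note car = carrier_cauchy_ring[OF p]
  note sub = subsetD[OF null_ideal_subset_padic_cauchy[OF p]]
  show ?thesis
  proof (rule idealI)
    show "ring (cauchy_ring p)" by (rule ring_axioms)
    show "subgroup (null_ideal p) (add_monoid (cauchy_ring p))"
    proof (rule add.subgroupI)
      show "null_ideal p \<noteq> {}" using zero_in_null_ideal by blast
      fix X assume "X \<in> null_ideal p"
      then show "\<ominus>\<^bsub>cauchy_ring p\<^esub> X \<in> null_ideal p"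
        using a_inv_cauchy_ring[OF p sub, of X] null_ideal_minus[of X p] by simp
    qed (use sub in \<open>auto simp: car cauchy_ring_simps null_ideal_add[OF p]\<close>)
    fix X Y assume XY: "X \<in> null_ideal p" "Y \<in> carrier (cauchy_ring p)"
    then show "X \<otimes>\<^bsub>cauchy_ring p\<^esub> Y \<in> null_ideal p"
      by (simp add: car cauchy_ring_simps null_ideal_mult[OF p])
    then show "Y \<otimes>\<^bsub>cauchy_ring p\<^esub> X \<in> null_ideal p"
      by (simp add: cauchy_ring_simps mult.commute)
  qed
qed

text \<open>Extends \<open>padic_of_rat\<close> from constant sequences to all sequences; every
  element of the field is the class of a Cauchy sequence, and computations are done on
  representatives.\<close>

definition padic_class :: "nat \<Rightarrow> (nat \<Rightarrow> rat) \<Rightarrow> padic" where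
  "padic_class p X = null_ideal p +>\<^bsub>cauchy_ring p\<^esub> X"

lemma mem_padic_class: "Y \<in> padic_class p X \<longleftrightarrow> (\<lambda>n. Y n - X n) \<in> null_ideal p"
proof
  assume "Y \<in> padic_class p X"
  then obtain h where "h \<in> null_ideal p" "Y = (\<lambda>n. h n + X n)"
    by (auto simp: padic_class_def a_r_coset_def' cauchy_ring_simps)
  then show "(\<lambda>n. Y n - X n) \<in> null_ideal p" by simp
next
  assume "(\<lambda>n. Y n - X n) \<in> null_ideal p"
  then show "Y \<in> padic_class p X"
    by (auto simp: padic_class_def a_r_coset_def' cauchy_ring_simps intro!: bexI[of _ "\<lambda>n. Y n - X n"])
qed

lemma cring_Qp:
  assumes p: "prime p"
  shows "cring (Qp p)"
  unfolding Qp_def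
  using ideal.quotient_is_cring[OF ideal_null_ideal[OF p] cring_cauchy_ring[OF p]] .

lemma carrier_Qp:
  assumes p: "prime p"
  shows "carrier (Qp p) = padic_class p ` padic_cauchy p"
  by (auto simp: Qp_def FactRing_def A_RCOSETS_def' carrier_cauchy_ring[OF p] padic_class_def)

lemma Qp_add:
  assumes p: "prime p" and X: "X \<in> padic_cauchy p" and Y: "Y \<in> padic_cauchy p"
  shows "padic_class p X \<oplus>\<^bsub>Qp p\<^esub> padic_class p Y = padic_class p (\<lambda>n. X n + Y n)"
proof -
  interpret ideal "null_ideal p" "cauchy_ring p" by (rule ideal_null_ideal[OF p])
  show ?thesis
    using a_rcos_sum[of X Y] X Y
    by (simp add: Qp_def FactRing_def padic_class_def carrier_cauchy_ring[OF p] cauchy_ring_simps)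
qed

lemma Qp_mult:
  assumes p: "prime p" and X: "X \<in> padic_cauchy p" and Y: "Y \<in> padic_cauchy p"
  shows "padic_class p X \<otimes>\<^bsub>Qp p\<^esub> padic_class p Y = padic_class p (\<lambda>n. X n * Y n)"
proof -
  interpret ideal "null_ideal p" "cauchy_ring p" by (rule ideal_null_ideal[OF p])
  show ?thesis
    using rcoset_mult_add[of X Y] X Y
    by (simp add: Qp_def FactRing_def padic_class_def carrier_cauchy_ring[OF p] cauchy_ring_simps)
qed

lemma Qp_one: "\<one>\<^bsub>Qp p\<^esub> = padic_of_rat p 1"
  by (simp add: Qp_def FactRing_def cauchy_ring_simps padic_of_rat_def)

lemma Qp_zero: "\<zero>\<^bsub>Qp p\<^esub> = padic_of_rat p 0"
  using mem_padic_class[of _ p "\<lambda>_. 0"]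
  by (auto simp: Qp_def FactRing_def padic_of_rat_def padic_class_def)

lemma padic_of_rat_eq_class: "padic_of_rat p r = padic_class p (\<lambda>_. r)"
  by (simp add: padic_of_rat_def padic_class_def)

lemma Qp_diff:
  assumes p: "prime p" and X: "X \<in> padic_cauchy p" and Y: "Y \<in> padic_cauchy p"
  shows "padic_class p X \<ominus>\<^bsub>Qp p\<^esub> padic_class p Y = padic_class p (\<lambda>n. X n - Y n)"
proof -
  interpret cring "Qp p" by (rule cring_Qp[OF p])
  have "\<ominus>\<^bsub>Qp p\<^esub> padic_class p Y = padic_class p (\<lambda>n. - Y n)"
    using Y padic_cauchy_minus[OF Y]
    by (intro minus_equality)
      (auto simp: Qp_add[OF p] Qp_zero padic_of_rat_eq_class carrier_Qp[OF p])
  then show ?thesis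
    using Qp_add[OF p X padic_cauchy_minus[OF Y]] by (simp add: a_minus_def)
qed

lemma padic_of_rat_closed [simp]: "prime p \<Longrightarrow> padic_of_rat p r \<in> carrier (Qp p)"
  by (simp add: padic_of_rat_eq_class carrier_Qp)

lemma padic_of_rat_add:
  "prime p \<Longrightarrow> padic_of_rat p (r + s) = padic_of_rat p r \<oplus>\<^bsub>Qp p\<^esub> padic_of_rat p s"
  by (simp add: padic_of_rat_eq_class Qp_add)

lemma padic_of_rat_diff:
  "prime p \<Longrightarrow> padic_of_rat p (r - s) = padic_of_rat p r \<ominus>\<^bsub>Qp p\<^esub> padic_of_rat p s"
  by (simp add: padic_of_rat_eq_class Qp_diff)

lemma padic_of_rat_mult:
  "prime p \<Longrightarrow> padic_of_rat p (r * s) = padic_of_rat p r \<otimes>\<^bsub>Qp p\<^esub> padic_of_rat p s"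
  by (simp add: padic_of_rat_eq_class Qp_mult)

lemma convergent_padic_abs_rat:
  assumes p: "prime p" and X: "X \<in> padic_cauchy p"
  shows "convergent (\<lambda>n. padic_abs_rat p (X n))"
proof (rule real_Cauchy_convergent, rule CauchyI)
  fix e :: real assume "e > 0"
  then obtain N where "\<forall>m\<ge>N. \<forall>n\<ge>N. padic_abs_rat p (X m - X n) < e"
    using X by (auto simp: padic_cauchy_def)
  then show "\<exists>M. \<forall>m\<ge>M. \<forall>n\<ge>M. norm (padic_abs_rat p (X m) - padic_abs_rat p (X n)) < e"
    using padic_abs_rat_triangle_sub[OF p] by (metis le_less_trans real_norm_def)
qed

text \<open>Representatives of one class differ by a null sequence, so the reverse triangle
  inequality gives their absolute values the same limit. The description in \<open>padic_abs\<close>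
  is thus well defined, and properties of the rational absolute value pass to the completion as
  limits.\<close>

lemma padic_abs_class_LIMSEQ:
  assumes p: "prime p" and X: "X \<in> padic_cauchy p"
  shows "(\<lambda>n. padic_abs_rat p (X n)) \<longlonglongrightarrow> padic_abs p (padic_class p X)"
proof -
  obtain r where r: "(\<lambda>n. padic_abs_rat p (X n)) \<longlonglongrightarrow> r"
    using convergent_padic_abs_rat[OF p X] by (auto simp: convergent_def)
  have "(\<lambda>n. padic_abs_rat p (Y n)) \<longlonglongrightarrow> r" if "Y \<in> padic_class p X" for Y
  proof (rule Lim_transform[OF r])
    have "(\<lambda>n. padic_abs_rat p (Y n - X n)) \<longlonglongrightarrow> 0"
      using that by (simp add: mem_padic_class null_ideal_def)
    then show "(\<lambda>n. padic_abs_rat p (Y n) - padic_abs_rat p (X n)) \<longlonglongrightarrow> 0"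
      using padic_abs_rat_triangle_sub[OF p]
      by (elim Lim_null_comparison[rotated]) (auto intro!: always_eventually)
  qed
  moreover have "X \<in> padic_class p X" by (simp add: mem_padic_class)
  ultimately have "padic_abs p (padic_class p X) = r"
    unfolding padic_abs_def using r by (intro the_equality) (auto intro: LIMSEQ_unique)
  then show ?thesis using r by simp
qed

lemma padic_abs_of_rat [simp]: "prime p \<Longrightarrow> padic_abs p (padic_of_rat p r) = padic_abs_rat p r"
  using padic_abs_class_LIMSEQ[of p "\<lambda>_. r"]
  by (simp add: padic_of_rat_eq_class LIMSEQ_const_iff)

lemma padic_abs_nonneg:
  assumes p: "prime p" and u: "u \<in> carrier (Qp p)"
  shows "0 \<le> padic_abs p u"
proof -
  obtain X where X: "X \<in> padic_cauchy p" "u = padic_class p X" using u by (auto simp: carrier_Qp[OF p])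
  show ?thesis unfolding X by (rule LIMSEQ_le_const[OF padic_abs_class_LIMSEQ[OF p X(1)]]) auto
qed

lemma padic_abs_ultrametric:
  assumes p: "prime p" and u: "u \<in> carrier (Qp p)" and v: "v \<in> carrier (Qp p)"
  shows "padic_abs p (u \<oplus>\<^bsub>Qp p\<^esub> v) \<le> max (padic_abs p u) (padic_abs p v)"
proof -
  obtain X where X: "X \<in> padic_cauchy p" "u = padic_class p X" using u by (auto simp: carrier_Qp[OF p])
  obtain Y where Y: "Y \<in> padic_cauchy p" "v = padic_class p Y" using v by (auto simp: carrier_Qp[OF p])
  show ?thesis unfolding X(2) Y(2) Qp_add[OF p X(1) Y(1)]
    using padic_abs_rat_ultrametric[OF p]
    by (intro LIMSEQ_le[OF padic_abs_class_LIMSEQ[OF p padic_cauchy_add[OF p X(1) Y(1)]]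
        tendsto_max[OF padic_abs_class_LIMSEQ[OF p X(1)] padic_abs_class_LIMSEQ[OF p Y(1)]]]) auto
qed

lemma padic_abs_minus_commute:
  assumes p: "prime p" and u: "u \<in> carrier (Qp p)" and v: "v \<in> carrier (Qp p)"
  shows "padic_abs p (u \<ominus>\<^bsub>Qp p\<^esub> v) = padic_abs p (v \<ominus>\<^bsub>Qp p\<^esub> u)"
proof -
  obtain X where X: "X \<in> padic_cauchy p" "u = padic_class p X" using u by (auto simp: carrier_Qp[OF p])
  obtain Y where Y: "Y \<in> padic_cauchy p" "v = padic_class p Y" using v by (auto simp: carrier_Qp[OF p])
  have c: "(\<lambda>n. X n - Y n) \<in> padic_cauchy p" "(\<lambda>n. Y n - X n) \<in> padic_cauchy p"
    using padic_cauchy_add[OF p X(1) padic_cauchy_minus[OF Y(1)]]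
      padic_cauchy_add[OF p Y(1) padic_cauchy_minus[OF X(1)]] by simp_all
  show ?thesis unfolding X(2) Y(2) Qp_diff[OF p X(1) Y(1)] Qp_diff[OF p Y(1) X(1)]
    using padic_abs_class_LIMSEQ[OF p c(1)] padic_abs_class_LIMSEQ[OF p c(2)]
    by (simp add: padic_abs_rat_minus_commute[of p "X _"] LIMSEQ_unique)
qed

lemma padic_abs_mult:
  assumes p: "prime p" and u: "u \<in> carrier (Qp p)" and v: "v \<in> carrier (Qp p)"
  shows "padic_abs p (u \<otimes>\<^bsub>Qp p\<^esub> v) = padic_abs p u * padic_abs p v"
proof -
  obtain X where X: "X \<in> padic_cauchy p" "u = padic_class p X" using u by (auto simp: carrier_Qp[OF p])
  obtain Y where Y: "Y \<in> padic_cauchy p" "v = padic_class p Y" using v by (auto simp: carrier_Qp[OF p])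
  have "(\<lambda>n. padic_abs_rat p (X n * Y n)) \<longlonglongrightarrow> padic_abs p u * padic_abs p v"
    unfolding X(2) Y(2) padic_abs_rat_mult[OF p]
    by (intro tendsto_mult padic_abs_class_LIMSEQ[OF p] X(1) Y(1))
  then show ?thesis
    unfolding X(2) Y(2) Qp_mult[OF p X(1) Y(1)]
    using padic_abs_class_LIMSEQ[OF p padic_cauchy_mult[OF p X(1) Y(1)]]
    by (rule LIMSEQ_unique[rotated])
qed

lemma padic_abs_eq_0:
  assumes p: "prime p" and u: "u \<in> carrier (Qp p)" and 0: "padic_abs p u = 0"
  shows "u = \<zero>\<^bsub>Qp p\<^esub>"
proof -
  obtain X where X: "X \<in> padic_cauchy p" "u = padic_class p X" using u by (auto simp: carrier_Qp[OF p])
  then have X0: "X \<in> null_ideal p"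
    using padic_abs_class_LIMSEQ[OF p X(1)] 0 by (simp add: null_ideal_def)
  have "Y \<in> u \<longleftrightarrow> Y \<in> null_ideal p" for Y
    using null_ideal_add[OF p _ X0, of "\<lambda>n. Y n - X n"]
      null_ideal_add[OF p _ null_ideal_minus[OF X0], of Y]
    unfolding X(2) mem_padic_class by auto
  then show ?thesis by (auto simp: Qp_def FactRing_def)
qed

lemma padic_abs_lt_self:
  assumes p: "prime p" and u: "u \<in> carrier (Qp p)" and lt: "padic_abs p u < real p"
  shows "padic_abs p u \<le> 1"
proof -
  obtain X where X: "X \<in> padic_cauchy p" "u = padic_class p X" using u by (auto simp: carrier_Qp[OF p])
  have "\<forall>\<^sub>F n in sequentially. padic_abs_rat p (X n) < real p"
    using order_tendstoD(2)[OF padic_abs_class_LIMSEQ[OF p X(1)]] lt X(2) by blast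
  then have "\<forall>\<^sub>F n in sequentially. padic_abs_rat p (X n) \<le> 1"
    by eventually_elim (rule padic_abs_rat_lt_self[OF p])
  then show ?thesis
    using tendsto_upperbound[OF padic_abs_class_LIMSEQ[OF p X(1)]] X(2) by simp
qed

lemma padic_of_rat_dense:
  assumes p: "prime p" and u: "u \<in> carrier (Qp p)" and e: "e > 0"
  obtains r where "padic_abs p (u \<ominus>\<^bsub>Qp p\<^esub> padic_of_rat p r) < e"
proof -
  obtain X where X: "X \<in> padic_cauchy p" "u = padic_class p X" using u by (auto simp: carrier_Qp[OF p])
  obtain N where N: "\<forall>m\<ge>N. \<forall>n\<ge>N. padic_abs_rat p (X m - X n) < e / 2"
    using padic_cauchyD[OF X(1), of "e / 2"] e by auto
  have c: "(\<lambda>n. X n - X N) \<in> padic_cauchy p"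
    using padic_cauchy_add[OF p X(1) padic_cauchy_const[of "- X N"]] by simp
  have "padic_abs p (padic_class p (\<lambda>n. X n - X N)) \<le> e / 2"
    using N by (intro tendsto_upperbound[OF padic_abs_class_LIMSEQ[OF p c]])
      (auto simp: eventually_sequentially intro!: exI[of _ N] less_imp_le)
  then have "padic_abs p (u \<ominus>\<^bsub>Qp p\<^esub> padic_of_rat p (X N)) < e"
    using e unfolding X(2) padic_of_rat_eq_class Qp_diff[OF p X(1) padic_cauchy_const] by simp
  then show ?thesis by (rule that)
qed

lemma padic_abs_triangle_max:
  assumes p: "prime p" and car: "u \<in> carrier (Qp p)" "v \<in> carrier (Qp p)" "w \<in> carrier (Qp p)"
  shows "padic_abs p (u \<ominus>\<^bsub>Qp p\<^esub> w) \<le>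
    max (padic_abs p (u \<ominus>\<^bsub>Qp p\<^esub> v)) (padic_abs p (v \<ominus>\<^bsub>Qp p\<^esub> w))"
proof -
  interpret cring "Qp p" by (rule cring_Qp[OF p])
  have "u \<ominus>\<^bsub>Qp p\<^esub> w = (u \<ominus>\<^bsub>Qp p\<^esub> v) \<oplus>\<^bsub>Qp p\<^esub> (v \<ominus>\<^bsub>Qp p\<^esub> w)"
    using car by algebra
  then show ?thesis using padic_abs_ultrametric[OF p, of "u \<ominus>\<^bsub>Qp p\<^esub> v" "v \<ominus>\<^bsub>Qp p\<^esub> w"] car by simp
qed

text \<open>Each \<open>u n\<close> is replaced by a rational at distance below 1 / (n + 1). These
  rationals form a Cauchy sequence, and its class is the limit.\<close>

lemma Qp_complete:
  fixes u :: "nat \<Rightarrow> padic"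
  assumes p: "prime p" and u: "\<And>n. u n \<in> carrier (Qp p)"
    and cau: "\<And>e. e > 0 \<Longrightarrow> \<exists>N. \<forall>m\<ge>N. \<forall>n\<ge>N. padic_abs p (u m \<ominus>\<^bsub>Qp p\<^esub> u n) < e"
  obtains v where "v \<in> carrier (Qp p)" "(\<lambda>n. padic_abs p (u n \<ominus>\<^bsub>Qp p\<^esub> v)) \<longlonglongrightarrow> 0"
proof -
  interpret cring "Qp p" by (rule cring_Qp[OF p])
  have "\<exists>r. padic_abs p (u n \<ominus>\<^bsub>Qp p\<^esub> padic_of_rat p r) < inverse (real (Suc n))" for n
    by (rule padic_of_rat_dense[OF p u, of "inverse (real (Suc n))" n]) auto
  then obtain y where y: "\<And>n. padic_abs p (u n \<ominus>\<^bsub>Qp p\<^esub> padic_of_rat p (y n)) < inverse (real (Suc n))"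
    by metis
  let ?y = "\<lambda>n. padic_of_rat p (y n)"
  have small: "\<exists>N. \<forall>n\<ge>N. padic_abs p (u n \<ominus>\<^bsub>Qp p\<^esub> ?y n) < e" if e: "e > 0" for e
  proof -
    obtain N where N: "inverse (real (Suc N)) < e" using reals_Archimedean[OF e] by blast
    have "padic_abs p (u n \<ominus>\<^bsub>Qp p\<^esub> ?y n) < e" if "n \<ge> N" for n
    proof -
      have "inverse (real (Suc n)) \<le> inverse (real (Suc N))" using that by (simp add: field_simps)
      then show ?thesis using y[of n] N by linarith
    qed
    then show ?thesis by blast
  qed
  have yc: "\<exists>N. \<forall>m\<ge>N. \<forall>n\<ge>N. padic_abs_rat p (y m - y n) < e" if e: "e > 0" for e
  proof -
    obtain N where N: "\<forall>n\<ge>N. padic_abs p (u n \<ominus>\<^bsub>Qp p\<^esub> ?y n) < e" using small[OF e] by blast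
    obtain M where M: "\<forall>m\<ge>M. \<forall>n\<ge>M. padic_abs p (u m \<ominus>\<^bsub>Qp p\<^esub> u n) < e" using cau[OF e] by blast
    have "padic_abs_rat p (y m - y n) < e" if "m \<ge> max N M" "n \<ge> max N M" for m n
    proof -
      have "padic_abs_rat p (y m - y n) = padic_abs p (?y m \<ominus>\<^bsub>Qp p\<^esub> ?y n)"
        using p by (simp flip: padic_of_rat_diff)
      also have "\<dots> \<le> max (padic_abs p (?y m \<ominus>\<^bsub>Qp p\<^esub> u m)) (padic_abs p (u m \<ominus>\<^bsub>Qp p\<^esub> ?y n))"
        using p u by (intro padic_abs_triangle_max) auto
      also have "padic_abs p (u m \<ominus>\<^bsub>Qp p\<^esub> ?y n) \<le>
          max (padic_abs p (u m \<ominus>\<^bsub>Qp p\<^esub> u n)) (padic_abs p (u n \<ominus>\<^bsub>Qp p\<^esub> ?y n))"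
        using p u by (intro padic_abs_triangle_max) auto
      finally show ?thesis
        using N M that padic_abs_minus_commute[OF p u, of "?y m" m] p by (auto simp: less_max_iff_disj)
          (smt (verit) max.bounded_iff)
    qed
    then show ?thesis by blast
  qed
  then have Y: "y \<in> padic_cauchy p" by (simp add: padic_cauchy_def)
  define v where "v = padic_class p y"
  have v: "v \<in> carrier (Qp p)" using Y by (simp add: v_def carrier_Qp[OF p])
  have "(\<lambda>n. padic_abs p (u n \<ominus>\<^bsub>Qp p\<^esub> v)) \<longlonglongrightarrow> 0"
  proof (rule LIMSEQ_I)
    fix e :: real assume e: "e > 0"
    then have e2: "e / 2 > 0" by simp
    obtain N where N: "\<forall>n\<ge>N. padic_abs p (u n \<ominus>\<^bsub>Qp p\<^esub> ?y n) < e" using small[OF e] by blast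
    obtain M where M: "\<forall>m\<ge>M. \<forall>n\<ge>M. padic_abs_rat p (y m - y n) < e / 2" using yc[OF e2] by blast
    have "norm (padic_abs p (u n \<ominus>\<^bsub>Qp p\<^esub> v) - 0) < e" if n: "n \<ge> max N M" for n
    proof -
      have c: "(\<lambda>m. y n - y m) \<in> padic_cauchy p"
        using padic_cauchy_add[OF p padic_cauchy_const[of "y n"] padic_cauchy_minus[OF Y]] by simp
      have "padic_abs p (?y n \<ominus>\<^bsub>Qp p\<^esub> v) = padic_abs p (padic_class p (\<lambda>m. y n - y m))"
        by (simp add: v_def padic_of_rat_eq_class Qp_diff[OF p padic_cauchy_const Y])
      also have "\<dots> \<le> e / 2"
        using M n by (intro tendsto_upperbound[OF padic_abs_class_LIMSEQ[OF p c]])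
          (auto simp: eventually_sequentially intro!: exI[of _ M] less_imp_le)
      finally have "padic_abs p (?y n \<ominus>\<^bsub>Qp p\<^esub> v) < e" using e by simp
      moreover have "padic_abs p (u n \<ominus>\<^bsub>Qp p\<^esub> ?y n) < e" using N n by simp
      ultimately have "padic_abs p (u n \<ominus>\<^bsub>Qp p\<^esub> v) < e"
        using padic_abs_triangle_max[OF p u _ v, of "?y n" n] p by simp
      then show ?thesis using padic_abs_nonneg[OF p, of "u n \<ominus>\<^bsub>Qp p\<^esub> v"] u v by simp
    qed
    then show "\<exists>N. \<forall>n\<ge>N. norm (padic_abs p (u n \<ominus>\<^bsub>Qp p\<^esub> v) - 0) < e" by blast
  qed
  with v show ?thesis by (rule that)
qed

section \<open>The restricted product as a metric ring\<close>

lemma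
  assumes p: "prime p" and u: "u \<in> Zp p" and v: "v \<in> Zp p"
  shows Zp_add: "u \<oplus>\<^bsub>Qp p\<^esub> v \<in> Zp p"
    and Zp_mult: "u \<otimes>\<^bsub>Qp p\<^esub> v \<in> Zp p"
    and Zp_diff: "u \<ominus>\<^bsub>Qp p\<^esub> v \<in> Zp p"
proof -
  interpret cring "Qp p" by (rule cring_Qp[OF p])
  have uv: "u \<in> carrier (Qp p)" "v \<in> carrier (Qp p)" "padic_abs p u \<le> 1" "padic_abs p v \<le> 1"
    using u v by (auto simp: Zp_def)
  show "u \<oplus>\<^bsub>Qp p\<^esub> v \<in> Zp p"
    using padic_abs_ultrametric[OF p uv(1,2)] uv by (simp add: Zp_def)
  show "u \<otimes>\<^bsub>Qp p\<^esub> v \<in> Zp p"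
    using padic_abs_mult[OF p uv(1,2)] uv padic_abs_nonneg[OF p]
    by (simp add: Zp_def mult_le_one)
  have "padic_abs p (\<zero>\<^bsub>Qp p\<^esub>) = 0" by (simp add: Qp_zero p)
  moreover have "u \<ominus>\<^bsub>Qp p\<^esub> \<zero>\<^bsub>Qp p\<^esub> = u" "v \<ominus>\<^bsub>Qp p\<^esub> \<zero>\<^bsub>Qp p\<^esub> = v"
    using uv by (simp_all add: a_minus_def)
  ultimately show "u \<ominus>\<^bsub>Qp p\<^esub> v \<in> Zp p"
    using padic_abs_triangle_max[OF p uv(1) zero_closed uv(2)]
      padic_abs_minus_commute[OF p zero_closed uv(2)] uv by (simp add: Zp_def)
qed

lemma Zp_of_rat: "prime p \<Longrightarrow> padic_of_rat p r \<in> Zp p \<longleftrightarrow> padic_abs_rat p r \<le> 1"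
  by (simp add: Zp_def)

lemma mem_cover_iff:
  "x \<in> carrier (cover P) \<longleftrightarrow>
    snd x \<in> (\<Pi>\<^sub>E p\<in>P. carrier (Qp p)) \<and> finite {p\<in>P. snd x p \<notin> Zp p}"
  by (simp add: cover_def)

lemma cover_simps:
  "mult (cover P) = (\<lambda>x y. (fst x * fst y, \<lambda>p\<in>P. snd x p \<otimes>\<^bsub>Qp p\<^esub> snd y p))"
  "one (cover P) = (1, \<lambda>p\<in>P. \<one>\<^bsub>Qp p\<^esub>)"
  "zero (cover P) = (0, \<lambda>p\<in>P. \<zero>\<^bsub>Qp p\<^esub>)"
  "add (cover P) = (\<lambda>x y. (fst x + fst y, \<lambda>p\<in>P. snd x p \<oplus>\<^bsub>Qp p\<^esub> snd y p))"
  by (simp_all add: cover_def)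

definition place_abs :: "nat \<Rightarrow> rat \<Rightarrow> real" where
  "place_abs i r = (if i = 0 then \<bar>of_rat r\<bar> else padic_abs_rat i r)"

text \<open>The weight 1 / p of the metric is built in. The distance in the cover is then the
  supremum over all places, and a cylinder is given by a bound \<open>e\<close> at its place, with
  no factor \<open>p\<close>.\<close>

definition place_dist :: "nat \<Rightarrow> cover_pt \<Rightarrow> cover_pt \<Rightarrow> real" where
  "place_dist i x z =
    (if i = 0 then \<bar>fst x - fst z\<bar> else padic_abs i (snd x i \<ominus>\<^bsub>Qp i\<^esub> snd z i) / real i)"

section \<open>The rings obtained from the integers by inverting a set of primes\<close>

lemma cring_rat_ring: "cring rat_ring"
proof (rule cringI)
  show "abelian_group rat_ring"
  proof (rule abelian_groupI)
    show "\<exists>y\<in>carrier rat_ring. y \<oplus>\<^bsub>rat_ring\<^esub> x = \<zero>\<^bsub>rat_ring\<^esub>" for x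
      by (rule bexI[of _ "- x"]) (auto simp: rat_ring_def)
  qed (auto simp: rat_ring_def)
  show "comm_monoid rat_ring"
    by (rule comm_monoidI) (auto simp: rat_ring_def)
qed (auto simp: rat_ring_def algebra_simps)

lemma a_inv_rat_ring: "\<ominus>\<^bsub>rat_ring\<^esub> x = - x"
proof -
  interpret cring rat_ring by (rule cring_rat_ring)
  show ?thesis by (rule minus_equality) (auto simp: rat_ring_def)
qed

text \<open>Only primes of \<open>Q\<close> can divide denominators in the generated ring. With
  \<open>Q\<close> the whole set of primes this locates large places of lattice elements; with the
  finite set of condition (2) it bounds the expansion at all other primes.\<close>

lemma invert_primes_le_1:
  assumes Q: "\<And>q. q \<in> Q \<Longrightarrow> prime q" and p: "prime p" "p \<notin> Q" and r: "r \<in> invert_primes Q"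
  shows "padic_abs_rat p r \<le> 1"
  using r unfolding invert_primes_def
proof (induction rule: generate_ring.induct)
  case one
  show ?case by (simp add: rat_ring_def)
next
  case (incl h)
  then obtain q where q: "q \<in> Q" "h = 1 / of_nat q" by blast
  then have "prime q" "q \<noteq> p" using Q p by auto
  then have "multiplicity (int p) (int q) = 0"
    using p by (intro prime_multiplicity_other) auto
  then show ?case
    using padic_abs_rat_divide_of_int[OF p(1), of 1 "int q"] q \<open>prime q\<close> by auto
next
  case (a_inv h)
  then show ?case by (simp add: a_inv_rat_ring)
next
  case (eng_add h1 h2)
  then show ?case by (simp add: rat_ring_def padic_abs_rat_add_le[OF p(1)])
next
  case (eng_mult h1 h2)
  then show ?case by (simp add: rat_ring_def padic_abs_rat_mult[OF p(1)] mult_le_one)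
qed

section \<open>The cover as a commutative ring containing the rationals diagonally\<close>

locale prime_set =
  fixes P :: "nat set"
  assumes prime: "p \<in> P \<Longrightarrow> prime p"
begin

abbreviation X where "X \<equiv> carrier (cover P)"
abbreviation R where "R \<equiv> invert_primes P"
abbreviation places where "places \<equiv> insert 0 P"
abbreviation d where "d \<equiv> cover_dist P"

lemma zero_notin_P [simp]: "0 \<notin> P"
  using prime not_prime_0 by blast

lemma P_pos: "p \<in> P \<Longrightarrow> p > 0"
  using prime prime_gt_0_nat by blast

lemma cover_coord: "x \<in> X \<Longrightarrow> p \<in> P \<Longrightarrow> snd x p \<in> carrier (Qp p)"
  by (auto simp: mem_cover_iff)

lemma cover_eqI:
  assumes "x \<in> X" "y \<in> X" "fst x = fst y" "\<And>p. p \<in> P \<Longrightarrow> snd x p = snd y p"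
  shows "x = y"
proof -
  have "snd x = snd y" using assms by (intro PiE_ext[of _ P "\<lambda>p. carrier (Qp p)"]) (auto simp: mem_cover_iff)
  then show ?thesis using assms(3) by (simp add: prod_eq_iff)
qed

text \<open>A coordinate of \<open>f\<close> can fail to be integral only where one of
  \<open>x\<close>, \<open>y\<close> fails, so finiteness of the exceptional set is inherited from
  them.\<close>

lemma mem_coverI:
  assumes "x \<in> X" "y \<in> X"
    and "\<And>p. p \<in> P \<Longrightarrow> f p \<in> carrier (Qp p)"
    and "\<And>p. p \<in> P \<Longrightarrow> snd x p \<in> Zp p \<Longrightarrow> snd y p \<in> Zp p \<Longrightarrow> f p \<in> Zp p"
  shows "(c, \<lambda>p\<in>P. f p) \<in> X"
proof -
  have "{p\<in>P. f p \<notin> Zp p} \<subseteq> {p\<in>P. snd x p \<notin> Zp p} \<union> {p\<in>P. snd y p \<notin> Zp p}"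
    using assms(4) by blast
  moreover have "finite ({p\<in>P. snd x p \<notin> Zp p} \<union> {p\<in>P. snd y p \<notin> Zp p})"
    using assms(1,2) by (simp add: mem_cover_iff)
  ultimately have "finite {p\<in>P. f p \<notin> Zp p}" by (rule finite_subset)
  then show ?thesis using assms(3) by (simp add: mem_cover_iff cong: conj_cong)
qed

text \<open>A rational is integral at every prime that does not divide its denominator.\<close>

lemma diag_closed [simp]: "diag P r \<in> X"
proof -
  have "{p\<in>P. padic_of_rat p r \<notin> Zp p} \<subseteq> {p. p dvd nat (snd (quotient_of r))}"
  proof
    fix p assume p: "p \<in> {p\<in>P. padic_of_rat p r \<notin> Zp p}"
    then have pp: "prime p" using prime by blast
    show "p \<in> {p. p dvd nat (snd (quotient_of r))}"
    proof (rule ccontr)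
      assume n: "p \<notin> {p. p dvd nat (snd (quotient_of r))}"
      have "snd (quotient_of r) > 0" by (rule quotient_of_denom_pos')
      then have "\<not> int p dvd snd (quotient_of r)"
        using n by (simp add: int_dvd_int_iff flip: nat_dvd_iff) (metis int_dvd_int_iff int_nat_eq less_imp_le)
      then have 0: "multiplicity (int p) (snd (quotient_of r)) = 0"
        by (rule not_dvd_imp_multiplicity_0)
      have "padic_abs_rat p r \<le> 1"
        unfolding padic_abs_rat_def 0 using prime_ge_1_nat[OF pp]
        by (auto simp: power_int_minus inverse_le_1_iff one_le_power)
      then show False using p pp by (simp add: Zp_of_rat)
    qed
  qed
  moreover have "finite {p. p dvd nat (snd (quotient_of r))}"
    using quotient_of_denom_pos'[of r] by (intro finite_divisors_nat) simp
  ultimately have "finite {p\<in>P. padic_of_rat p r \<notin> Zp p}" by (rule finite_subset)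
  then show ?thesis using prime by (simp add: diag_def mem_cover_iff cong: conj_cong)
qed

lemma cover_add_closed: "x \<in> X \<Longrightarrow> y \<in> X \<Longrightarrow> x \<oplus>\<^bsub>cover P\<^esub> y \<in> X"
  unfolding cover_simps
  by (rule mem_coverI[of x y])
    (auto simp: cover_coord prime Zp_add cring.cring_simprules(1)[OF cring_Qp])

lemma cover_mult_closed: "x \<in> X \<Longrightarrow> y \<in> X \<Longrightarrow> x \<otimes>\<^bsub>cover P\<^esub> y \<in> X"
  unfolding cover_simps
  by (rule mem_coverI[of x y])
    (auto simp: cover_coord prime Zp_mult cring.cring_simprules(5)[OF cring_Qp])

lemma diag_0: "diag P 0 = \<zero>\<^bsub>cover P\<^esub>"
  by (simp add: diag_def cover_simps Qp_zero)

lemma diag_1: "diag P 1 = \<one>\<^bsub>cover P\<^esub>"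
  by (simp add: diag_def cover_simps Qp_one)

lemma cring_cover: "cring (cover P)"
proof (rule cringI)
  have Q: "cring (Qp p)" if "p \<in> P" for p using cring_Qp prime that by blast
  note rules = cring.cring_simprules[OF Q]
  have a_comm: "u \<oplus>\<^bsub>Qp p\<^esub> v = v \<oplus>\<^bsub>Qp p\<^esub> u" and m_comm: "u \<otimes>\<^bsub>Qp p\<^esub> v = v \<otimes>\<^bsub>Qp p\<^esub> u"
    if "p \<in> P" "u \<in> carrier (Qp p)" "v \<in> carrier (Qp p)" for p u v
  proof -
    interpret Q: cring "Qp p" by (rule Q[OF that(1)])
    show "u \<oplus>\<^bsub>Qp p\<^esub> v = v \<oplus>\<^bsub>Qp p\<^esub> u" "u \<otimes>\<^bsub>Qp p\<^esub> v = v \<otimes>\<^bsub>Qp p\<^esub> u"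
      using that Q.a_comm Q.m_comm by blast+
  qed
  show "abelian_group (cover P)"
  proof (rule abelian_groupI)
    show "\<zero>\<^bsub>cover P\<^esub> \<in> X" using diag_closed[of 0] by (simp add: diag_0)
    then have z: "(0, \<lambda>p\<in>P. \<zero>\<^bsub>Qp p\<^esub>) \<in> X" by (simp add: cover_simps)
    fix x y z assume xyz: "x \<in> X" "y \<in> X" "z \<in> X"
    show "(x \<oplus>\<^bsub>cover P\<^esub> y) \<oplus>\<^bsub>cover P\<^esub> z = x \<oplus>\<^bsub>cover P\<^esub> (y \<oplus>\<^bsub>cover P\<^esub> z)"
      using xyz by (intro cover_eqI cover_add_closed) (auto simp: cover_simps rules cover_coord)
    show "x \<oplus>\<^bsub>cover P\<^esub> y = y \<oplus>\<^bsub>cover P\<^esub> x"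
      using xyz by (intro cover_eqI cover_add_closed) (simp_all add: cover_simps cover_coord a_comm)
    show "\<zero>\<^bsub>cover P\<^esub> \<oplus>\<^bsub>cover P\<^esub> x = x"
      using xyz \<open>\<zero>\<^bsub>cover P\<^esub> \<in> X\<close>
      by (intro cover_eqI cover_add_closed) (auto simp: cover_simps rules cover_coord)
    \<comment> \<open>The negative is written as a difference from zero so that the closure of
      \<open>Zp p\<close> under differences applies.\<close>
    let ?y = "(- fst x, \<lambda>p\<in>P. \<zero>\<^bsub>Qp p\<^esub> \<ominus>\<^bsub>Qp p\<^esub> snd x p)"
    have y: "?y \<in> X"
    proof (rule mem_coverI[OF \<open>\<zero>\<^bsub>cover P\<^esub> \<in> X\<close> xyz(1)])
      fix p assume p: "p \<in> P"
      show "\<zero>\<^bsub>Qp p\<^esub> \<ominus>\<^bsub>Qp p\<^esub> snd x p \<in> carrier (Qp p)"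
        using p xyz by (intro rules(2,4) cover_coord)
      assume "snd (\<zero>\<^bsub>cover P\<^esub>) p \<in> Zp p" "snd x p \<in> Zp p"
      then show "\<zero>\<^bsub>Qp p\<^esub> \<ominus>\<^bsub>Qp p\<^esub> snd x p \<in> Zp p"
        using p Zp_diff[OF prime[OF p]] by (simp add: cover_simps)
    qed
    show "\<exists>y\<in>X. y \<oplus>\<^bsub>cover P\<^esub> x = \<zero>\<^bsub>cover P\<^esub>"
      using xyz y \<open>\<zero>\<^bsub>cover P\<^esub> \<in> X\<close>
      by (intro bexI[of _ ?y] cover_eqI cover_add_closed)
        (auto simp: cover_simps rules cover_coord)
  qed (rule cover_add_closed)
  show "comm_monoid (cover P)"
  proof (rule comm_monoidI)
    show one: "\<one>\<^bsub>cover P\<^esub> \<in> X" using diag_closed[of 1] by (simp add: diag_1)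
    fix x y z assume xyz: "x \<in> X" "y \<in> X" "z \<in> X"
    show "(x \<otimes>\<^bsub>cover P\<^esub> y) \<otimes>\<^bsub>cover P\<^esub> z = x \<otimes>\<^bsub>cover P\<^esub> (y \<otimes>\<^bsub>cover P\<^esub> z)"
      using xyz by (intro cover_eqI cover_mult_closed) (auto simp: cover_simps rules cover_coord)
    show "x \<otimes>\<^bsub>cover P\<^esub> y = y \<otimes>\<^bsub>cover P\<^esub> x"
      using xyz by (intro cover_eqI cover_mult_closed) (simp_all add: cover_simps cover_coord m_comm)
    show "\<one>\<^bsub>cover P\<^esub> \<otimes>\<^bsub>cover P\<^esub> x = x"
      using xyz one by (intro cover_eqI cover_mult_closed) (auto simp: cover_simps rules cover_coord)
  qed (rule cover_mult_closed)
  show "(x \<oplus>\<^bsub>cover P\<^esub> y) \<otimes>\<^bsub>cover P\<^esub> z = x \<otimes>\<^bsub>cover P\<^esub> z \<oplus>\<^bsub>cover P\<^esub> y \<otimes>\<^bsub>cover P\<^esub> z"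
    if "x \<in> X" "y \<in> X" "z \<in> X" for x y z
    using that by (intro cover_eqI cover_mult_closed cover_add_closed)
      (auto simp: cover_simps rules(13) cover_coord distrib_right)
qed

sublocale cover: cring "cover P" by (rule cring_cover)

lemma fst_add [simp]: "fst (x \<oplus>\<^bsub>cover P\<^esub> y) = fst x + fst y"
  and snd_add [simp]: "p \<in> P \<Longrightarrow> snd (x \<oplus>\<^bsub>cover P\<^esub> y) p = snd x p \<oplus>\<^bsub>Qp p\<^esub> snd y p"
  and fst_mult [simp]: "fst (x \<otimes>\<^bsub>cover P\<^esub> y) = fst x * fst y"
  and snd_mult [simp]: "p \<in> P \<Longrightarrow> snd (x \<otimes>\<^bsub>cover P\<^esub> y) p = snd x p \<otimes>\<^bsub>Qp p\<^esub> snd y p"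
  by (simp_all add: cover_simps)

lemma fst_diag [simp]: "fst (diag P r) = of_rat r"
  and snd_diag [simp]: "p \<in> P \<Longrightarrow> snd (diag P r) p = padic_of_rat p r"
  by (simp_all add: diag_def)

lemma diag_add: "diag P (r + s) = diag P r \<oplus>\<^bsub>cover P\<^esub> diag P s"
  by (rule cover_eqI) (auto simp: of_rat_add padic_of_rat_add prime)

lemma diag_mult: "diag P (r * s) = diag P r \<otimes>\<^bsub>cover P\<^esub> diag P s"
  by (rule cover_eqI) (auto simp: of_rat_mult padic_of_rat_mult prime)

lemma diag_minus: "diag P (- r) = \<ominus>\<^bsub>cover P\<^esub> diag P r"
  by (rule cover.minus_equality[symmetric]) (simp_all flip: diag_add diag_0)

lemma diag_diff: "diag P (r - s) = diag P r \<ominus>\<^bsub>cover P\<^esub> diag P s"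
  using diag_add[of r "- s"] by (simp add: diag_minus a_minus_def)

lemma diag_inject [simp]: "diag P r = diag P s \<longleftrightarrow> r = s"
  by (metis fst_diag of_rat_eq_iff)

section \<open>The metric of the cover, one place at a time\<close>

lemma Qp_cring: "p \<in> P \<Longrightarrow> cring (Qp p)"
  using cring_Qp prime by blast

lemma Qp_diff_closed: "p \<in> P \<Longrightarrow> x \<in> X \<Longrightarrow> y \<in> X \<Longrightarrow> snd x p \<ominus>\<^bsub>Qp p\<^esub> snd y p \<in> carrier (Qp p)"
  using cring.cring_simprules(4)[OF Qp_cring] cover_coord by blast

lemma place_dist_nonneg: "i \<in> places \<Longrightarrow> x \<in> X \<Longrightarrow> y \<in> X \<Longrightarrow> 0 \<le> place_dist i x y"
  by (auto simp: place_dist_def prime Qp_diff_closed padic_abs_nonneg)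

lemma place_dist_commute:
  "i \<in> places \<Longrightarrow> x \<in> X \<Longrightarrow> y \<in> X \<Longrightarrow> place_dist i x y = place_dist i y x"
  by (auto simp: place_dist_def prime cover_coord padic_abs_minus_commute[of i "snd x i"])

lemma place_dist_triangle:
  assumes "i \<in> places" "x \<in> X" "y \<in> X" "z \<in> X"
  shows "place_dist i x z \<le> place_dist i x y + place_dist i y z"
proof (cases "i = 0")
  case False
  then have i: "i \<in> P" using assms by simp
  have "padic_abs i (snd x i \<ominus>\<^bsub>Qp i\<^esub> snd z i) \<le>
    padic_abs i (snd x i \<ominus>\<^bsub>Qp i\<^esub> snd y i) + padic_abs i (snd y i \<ominus>\<^bsub>Qp i\<^esub> snd z i)"
    using padic_abs_triangle_max[OF prime[OF i], of "snd x i" "snd y i" "snd z i"]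
      padic_abs_nonneg[OF prime[OF i] Qp_diff_closed[OF i]] assms(2-4) cover_coord[OF _ i]
    by (smt (verit, best))
  then show ?thesis using P_pos[OF i] by (simp add: place_dist_def field_simps)
qed (simp add: place_dist_def)

lemma place_dist_ultra:
  assumes "i \<in> P" "x \<in> X" "y \<in> X" "z \<in> X"
  shows "place_dist i x z \<le> max (place_dist i x y) (place_dist i y z)"
proof -
  have "padic_abs i (snd x i \<ominus>\<^bsub>Qp i\<^esub> snd z i) \<le>
    max (padic_abs i (snd x i \<ominus>\<^bsub>Qp i\<^esub> snd y i)) (padic_abs i (snd y i \<ominus>\<^bsub>Qp i\<^esub> snd z i))"
    using assms by (intro padic_abs_triangle_max prime cover_coord)
  then show ?thesis using P_pos[OF assms(1)] by (auto simp: place_dist_def le_max_iff_disj divide_right_mono)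
qed

lemma Qp_diff_self:
  assumes "p \<in> P" "x \<in> X"
  shows "snd x p \<ominus>\<^bsub>Qp p\<^esub> snd x p = padic_of_rat p 0"
proof -
  interpret Q: cring "Qp p" by (rule Qp_cring[OF assms(1)])
  show ?thesis using cover_coord[OF assms(2,1)] Q.r_right_minus_eq by (simp add: Qp_zero)
qed

lemma place_dist_self: "i \<in> places \<Longrightarrow> x \<in> X \<Longrightarrow> place_dist i x x = 0"
  by (cases "i = 0") (simp_all add: place_dist_def Qp_diff_self prime)

lemma place_dist_eq_0_imp_eq:
  assumes "x \<in> X" "y \<in> X" "\<And>i. i \<in> places \<Longrightarrow> place_dist i x y = 0"
  shows "x = y"
proof (rule cover_eqI)
  show "fst x = fst y" using assms(3)[of 0] by (simp add: place_dist_def)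
  fix p assume p: "p \<in> P"
  interpret Q: cring "Qp p" by (rule Qp_cring[OF p])
  have "padic_abs p (snd x p \<ominus>\<^bsub>Qp p\<^esub> snd y p) = 0"
    using assms(3)[of p] p P_pos[OF p] by (auto simp: place_dist_def)
  then have "snd x p \<ominus>\<^bsub>Qp p\<^esub> snd y p = \<zero>\<^bsub>Qp p\<^esub>"
    using padic_abs_eq_0[OF prime[OF p] Qp_diff_closed[OF p]] assms by blast
  then show "snd x p = snd y p" using cover_coord[OF _ p] assms Q.r_right_minus_eq by blast
qed (use assms in auto)

lemma cover_dist_Sup:
  assumes "x \<in> X" "y \<in> X"
  shows "d x y = Sup ((\<lambda>i. place_dist i x y) ` places)"
proof -
  have "insert \<bar>fst x - fst y\<bar> ((\<lambda>p. padic_abs p (snd x p \<ominus>\<^bsub>Qp p\<^esub> snd y p) / real p) ` P)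
      = (\<lambda>i. place_dist i x y) ` places"
    unfolding image_insert
    by (intro arg_cong2[where f = insert] image_cong) (auto simp: place_dist_def dest: P_pos)
  then show ?thesis using assms by (simp add: cover_dist_def)
qed

text \<open>Outside finitely many primes both coordinates are integral, and their difference has
  absolute value at most 1. Boundedness is what lets the supremum in the metric be compared with its
  terms.\<close>

lemma bdd_above_place_dist:
  assumes "x \<in> X" "y \<in> X"
  shows "bdd_above ((\<lambda>i. place_dist i x y) ` places)"
proof -
  define S where "S = {p\<in>P. snd x p \<notin> Zp p} \<union> {p\<in>P. snd y p \<notin> Zp p}"
  have "finite S" using assms by (simp add: S_def mem_cover_iff)
  have "place_dist p x y \<le> 1" if p: "p \<in> P - S" for p
  proof -
    have "snd x p \<ominus>\<^bsub>Qp p\<^esub> snd y p \<in> Zp p" using p by (intro Zp_diff prime) (auto simp: S_def)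
    then have "padic_abs p (snd x p \<ominus>\<^bsub>Qp p\<^esub> snd y p) \<le> real p"
      using P_pos[of p] p by (auto simp: Zp_def)
    then show ?thesis using p P_pos[of p] by (simp add: place_dist_def)
  qed
  then have "bdd_above ((\<lambda>i. place_dist i x y) ` (P - S))" by (auto intro!: bdd_aboveI[of _ 1])
  moreover have "bdd_above ((\<lambda>i. place_dist i x y) ` insert 0 S)" using \<open>finite S\<close> by simp
  ultimately have "bdd_above ((\<lambda>i. place_dist i x y) ` ((P - S) \<union> insert 0 S))"
    unfolding image_Un by simp
  moreover have "places \<subseteq> (P - S) \<union> insert 0 S" by auto
  ultimately show ?thesis by (meson bdd_above_mono image_mono)
qed

lemma cover_dist_le_iff:
  assumes "x \<in> X" "y \<in> X"
  shows "d x y \<le> c \<longleftrightarrow> (\<forall>i\<in>places. place_dist i x y \<le> c)"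
  unfolding cover_dist_Sup[OF assms]
  using cSup_le_iff[OF _ bdd_above_place_dist[OF assms]] by simp

lemma place_dist_le:
  "i \<in> places \<Longrightarrow> x \<in> X \<Longrightarrow> y \<in> X \<Longrightarrow> place_dist i x y \<le> d x y"
  using cover_dist_le_iff by blast

sublocale cover: Metric_space X d
proof
  fix x y
  show "0 \<le> d x y"
  proof (cases "x \<in> X \<and> y \<in> X")
    case True
    then show ?thesis using place_dist_le[of 0 x y] place_dist_nonneg[of 0 x y] by simp
  qed (auto simp: cover_dist_def)
  show "d x y = d y x"
  proof (cases "x \<in> X \<and> y \<in> X")
    case True
    then show ?thesis using place_dist_commute[of _ x y] by (simp only: cover_dist_Sup cong: image_cong)
  qed (auto simp: cover_dist_def)
next
  fix x y assume xy: "x \<in> X" "y \<in> X"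
  show "(d x y = 0) = (x = y)"
  proof
    assume 0: "d x y = 0"
    then have "place_dist i x y = 0" if "i \<in> places" for i
      using place_dist_le[OF that xy] place_dist_nonneg[OF that xy] by simp
    then show "x = y" using place_dist_eq_0_imp_eq xy by blast
  next
    assume "x = y"
    then show "d x y = 0"
      using xy cover_dist_Sup[of x x] image_cong[OF refl place_dist_self[of _ x], of places]
      by (simp add: image_constant_conv del: image_insert)
  qed
next
  fix x y z assume xyz: "x \<in> X" "y \<in> X" "z \<in> X"
  show "d x z \<le> d x y + d y z"
    unfolding cover_dist_le_iff[OF xyz(1,3)]
    using place_dist_triangle[OF _ xyz] place_dist_le xyz by (meson add_mono order_trans)
qed

lemma place_dist_add_right:
  assumes "i \<in> places" "x \<in> X" "y \<in> X" "w \<in> X"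
  shows "place_dist i (x \<oplus>\<^bsub>cover P\<^esub> w) (y \<oplus>\<^bsub>cover P\<^esub> w) = place_dist i x y"
proof (cases "i = 0")
  case False
  then have i: "i \<in> P" using assms by simp
  interpret Q: cring "Qp i" by (rule Qp_cring[OF i])
  have "(snd x i \<oplus>\<^bsub>Qp i\<^esub> snd w i) \<ominus>\<^bsub>Qp i\<^esub> (snd y i \<oplus>\<^bsub>Qp i\<^esub> snd w i) = snd x i \<ominus>\<^bsub>Qp i\<^esub> snd y i"
    using cover_coord[OF _ i] assms by algebra
  then show ?thesis using i by (simp add: place_dist_def)
qed (simp add: place_dist_def)

lemma place_dist_diag_mult:
  assumes "i \<in> places" "x \<in> X" "y \<in> X"
  shows "place_dist i (diag P r \<otimes>\<^bsub>cover P\<^esub> x) (diag P r \<otimes>\<^bsub>cover P\<^esub> y) = place_abs i r * place_dist i x y"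
proof (cases "i = 0")
  case False
  then have i: "i \<in> P" using assms by simp
  interpret Q: cring "Qp i" by (rule Qp_cring[OF i])
  have "(padic_of_rat i r \<otimes>\<^bsub>Qp i\<^esub> snd x i) \<ominus>\<^bsub>Qp i\<^esub> (padic_of_rat i r \<otimes>\<^bsub>Qp i\<^esub> snd y i)
      = padic_of_rat i r \<otimes>\<^bsub>Qp i\<^esub> (snd x i \<ominus>\<^bsub>Qp i\<^esub> snd y i)"
    using cover_coord[OF _ i] assms padic_of_rat_closed[OF prime[OF i]] by algebra
  then show ?thesis
    using i assms False padic_abs_mult[OF prime[OF i] padic_of_rat_closed[OF prime[OF i]] Qp_diff_closed[OF i]]
    by (simp add: place_dist_def place_abs_def prime)
qed (simp add: place_dist_def place_abs_def abs_mult flip: right_diff_distrib)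

lemma cover_dist_cong:
  assumes "x \<in> X" "y \<in> X" "x' \<in> X" "y' \<in> X"
    and "\<And>i. i \<in> places \<Longrightarrow> place_dist i x y = place_dist i x' y'"
  shows "d x y = d x' y'"
  using assms by (simp only: cover_dist_Sup cong: image_cong)

lemma cover_dist_add_right:
  assumes "x \<in> X" "y \<in> X" "w \<in> X"
  shows "d (x \<oplus>\<^bsub>cover P\<^esub> w) (y \<oplus>\<^bsub>cover P\<^esub> w) = d x y"
  using assms place_dist_add_right[OF _ assms] by (intro cover_dist_cong) auto

section \<open>The diagonal lattice\<close>

lemma lattice_one [simp]: "1 \<in> R"
  using generate_ring.one[of rat_ring] by (simp add: invert_primes_def rat_ring_def)

lemma lattice_add: "r \<in> R \<Longrightarrow> s \<in> R \<Longrightarrow> r + s \<in> R"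
  using generate_ring.eng_add[of r rat_ring _ s] by (simp add: invert_primes_def rat_ring_def)

lemma lattice_mult: "r \<in> R \<Longrightarrow> s \<in> R \<Longrightarrow> r * s \<in> R"
  using generate_ring.eng_mult[of r rat_ring _ s] by (simp add: invert_primes_def rat_ring_def)

lemma lattice_minus: "r \<in> R \<Longrightarrow> - r \<in> R"
  using generate_ring.a_inv[of r rat_ring] by (simp add: invert_primes_def a_inv_rat_ring)

lemma lattice_diff: "r \<in> R \<Longrightarrow> s \<in> R \<Longrightarrow> r - s \<in> R"
  using lattice_add[OF _ lattice_minus, of r s] by simp

lemma lattice_zero [simp]: "0 \<in> R"
  using lattice_diff[of 1 1] by simp

lemma lattice_power: "r \<in> R \<Longrightarrow> r ^ k \<in> R"
  by (induction k) (auto intro: lattice_mult)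

text \<open>If \<open>s = a / b\<close> is in lowest terms and nonzero with absolute value below 1,
  then \<open>b\<close> exceeds 1 and has a prime factor \<open>p\<close>, which does not divide
  \<open>a\<close>. This \<open>p\<close> lies in \<open>P\<close> because elements of
  \<open>R\<close> are integral elsewhere. The bound \<open>p\<close> is exactly what the weight 1 /
  p in the metric requires.\<close>

lemma exists_large_place:
  assumes s: "s \<in> R" "s \<noteq> 0" "\<bar>s\<bar> < 1"
  shows "\<exists>p\<in>P. real p \<le> padic_abs_rat p s"
proof -
  obtain a b where q: "quotient_of s = (a, b)" by (cases "quotient_of s")
  have b: "b > 0" and cop: "coprime a b" and sab: "s = of_int a / of_int b"
    using quotient_of_denom_pos[OF q] quotient_of_coprime[OF q] quotient_of_div[OF q] by auto
  have a: "a \<noteq> 0" using s sab by auto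
  have "\<bar>rat_of_int a\<bar> < rat_of_int b" using s(3) b sab by (simp add: field_simps abs_divide)
  then have "\<bar>a\<bar> < b" by linarith
  then have "b > 1" using a by linarith
  then have "nat b \<noteq> 1" by linarith
  then obtain p where p: "prime p" "p dvd nat b" using prime_factor_nat by blast
  have pb: "int p dvd b" using p(2) b by (simp add: int_dvd_int_iff flip: int_dvd_int_iff)
  have "\<not> int p dvd a"
    using cop pb p(1) by (meson coprime_common_divisor not_prime_unit prime_nat_int_transfer)
  then have "multiplicity (int p) a = 0" by (rule not_dvd_imp_multiplicity_0)
  moreover have "multiplicity (int p) b \<ge> 1"
    using pb p b prime_multiplicity_gt_zero_iff[of "int p" b] by simp
  moreover have p1: "real p > 1" using prime_gt_1_nat[OF p(1)] by simp
  ultimately have "real p powi 1 \<le> padic_abs_rat p s"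
    unfolding sab padic_abs_rat_divide_of_int[OF p(1) a less_imp_neq[OF b, symmetric]]
    by (intro power_int_increasing) auto
  then have le: "real p \<le> padic_abs_rat p s" by simp
  have "p \<in> P"
  proof (rule ccontr)
    assume "p \<notin> P"
    then have "padic_abs_rat p s \<le> 1" using invert_primes_le_1 prime p(1) s(1) by blast
    then show False using le p1 by simp
  qed
  then show ?thesis using le by blast
qed

text \<open>Either the difference of \<open>s\<close> and \<open>s'\<close> is at least 1 at the
  real place, or some prime of \<open>P\<close> sees it with absolute value at least
  \<open>p\<close>, that is, with weighted distance at least 1.\<close>

lemma lattice_separated:
  assumes "s \<in> R" "s' \<in> R" "s \<noteq> s'"
  shows "1 \<le> d (diag P (t + s)) (diag P (t + s'))"
proof -
  have sub: "t + s - (t + s') = s - s'" by simp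
  show ?thesis
  proof (cases "\<bar>s - s'\<bar> < 1")
    case True
    then obtain p where p: "p \<in> P" "real p \<le> padic_abs_rat p (s - s')"
      using exists_large_place[OF lattice_diff[OF assms(1,2)]] assms(3) by auto
    have "place_dist p (diag P (t + s)) (diag P (t + s')) = padic_abs_rat p (s - s') / real p"
      using p P_pos[OF p(1)] prime[OF p(1)] sub by (simp add: place_dist_def flip: padic_of_rat_diff)
    then have "1 \<le> place_dist p (diag P (t + s)) (diag P (t + s'))"
      using p P_pos[OF p(1)] by simp
    then show ?thesis using place_dist_le[of p "diag P (t + s)" "diag P (t + s')"] p by simp
  next
    case False
    have "real_of_rat (t + s) - real_of_rat (t + s') = real_of_rat (s - s')"
      by (simp add: sub flip: of_rat_diff)
    then have "place_dist 0 (diag P (t + s)) (diag P (t + s')) = real_of_rat \<bar>s - s'\<bar>"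
      by (simp add: place_dist_def del: of_rat_add of_rat_diff) 
    moreover have "real_of_rat \<bar>s - s'\<bar> \<ge> 1" using False by (metis not_less of_rat_1 of_rat_less_eq)
    moreover have "place_dist 0 (diag P (t + s)) (diag P (t + s')) \<le> d (diag P (t + s)) (diag P (t + s'))"
      by (rule place_dist_le) auto
    ultimately show ?thesis by linarith
  qed
qed


section \<open>Balls and cylinders\<close>

lemma mem_cball_iff:
  assumes "x \<in> X" "y \<in> X"
  shows "y \<in> cover_cball P x r \<longleftrightarrow> (\<forall>i\<in>places. place_dist i x y \<le> r)"
  using assms cover_dist_le_iff[OF assms] by simp

lemma mem_cylinder:
  assumes "i \<in> places"
  shows "z \<in> cylinder P x e i \<longleftrightarrow> z \<in> X \<and> place_dist i z x < e"
  using assms P_pos[of i] by (auto simp: cylinder_def place_dist_def field_simps)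

lemma cylinder_radius_le:
  assumes "e > 0"
  shows "cylinder_radius P x e i \<le> e"
  using assms by (auto simp: cylinder_radius_def intro!: cInf_lower bdd_belowI[of _ 0])

definition shift :: "cover_pt \<Rightarrow> real \<Rightarrow> cover_pt" where
  "shift x c = (fst x + c, snd x)"

lemma shift_closed [simp]: "x \<in> X \<Longrightarrow> shift x c \<in> X"
  by (simp add: shift_def mem_cover_iff)

lemma place_dist_shift:
  "place_dist i x (shift x c) = (if i = 0 then \<bar>c\<bar> else place_dist i x x)"
  by (simp add: shift_def place_dist_def)

lemma cover_dist_shift_le: "x \<in> X \<Longrightarrow> \<bar>c\<bar> \<le> r \<Longrightarrow> d x (shift x c) \<le> r"
  using place_dist_self by (subst cover_dist_le_iff) (auto simp: place_dist_shift)

text \<open>Test the inclusion on the two points of the smaller ball that are extreme in the real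
  coordinate. This gives the uniqueness of radii, their monotonicity along a play, and the halving
  move.\<close>

lemma cball_subset_real:
  assumes x: "x \<in> X" "x' \<in> X" and r: "r' > 0" and sub: "cover_cball P x' r' \<subseteq> cover_cball P x r"
  shows "\<bar>fst x' - fst x\<bar> + r' \<le> r"
proof -
  have "\<bar>fst x - (fst x' + c)\<bar> \<le> r" if "\<bar>c\<bar> = r'" for c
  proof -
    have "shift x' c \<in> cover_cball P x r"
      using subsetD[OF sub, of "shift x' c"] cover_dist_shift_le[OF x(2), of c r'] that x by simp
    then show ?thesis
      using mem_cball_iff[OF x(1), of "shift x' c" r] x by (simp add: place_dist_def shift_def)
  qed
  from this[of r'] this[of "- r'"] r show ?thesis by linarith
qed

lemma ball_radius_cball:
  assumes "x \<in> X" "r > 0"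
  shows "ball_radius P (cover_cball P x r) = r"
  unfolding ball_radius_def
proof (rule the_equality)
  fix r' assume "r' > 0 \<and> (\<exists>x'\<in>X. cover_cball P x r = cover_cball P x' r')"
  then obtain x' where "x' \<in> X" "r' > 0" "cover_cball P x r = cover_cball P x' r'" by blast
  then show "r' = r"
    using cball_subset_real[of x x' r' r] cball_subset_real[of x' x r r'] assms by auto
qed (use assms in blast)

lemma closed_ballE:
  assumes "closed_ball P B"
  obtains x where "x \<in> X" "ball_radius P B > 0" "B = cover_cball P x (ball_radius P B)"
  using assms ball_radius_cball by (auto simp: closed_ball_def)

text \<open>Bob is never stuck after such a move of Alice. At the real place one end of the ball is
  free because \<open>\<beta>\<close> is at most 1/3; at a prime \<open>i\<close> the condition
  \<open>\<beta> * real i < 1\<close> leaves a residue disc outside the cylinder.\<close>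

lemma exists_ball_avoiding_cylinder:
  assumes x: "x \<in> X" and r: "r > 0" and z: "z \<in> X" and i: "i \<in> places"
    and \<beta>: "0 < \<beta>" "\<beta> \<le> 1/3" "\<beta> * real i < 1"
  shows "\<exists>x'\<in>X. cover_cball P x' (\<beta> * r) \<subseteq> cover_cball P x r - cylinder P z (\<beta> * r) i"
proof (cases "i = 0")
  case True
  \<comment> \<open>The new centre is pushed away from \<open>z\<close> as far as a ball of radius
    \<open>\<beta> * r\<close> allows within the old one.\<close>
  define c where "c = (if fst x \<ge> fst z then (1 - \<beta>) * r else - ((1 - \<beta>) * r))"
  have br: "\<beta> * r \<le> r / 3" using \<beta> r by (simp add: field_simps)
  then have b2: "2 * (\<beta> * r) \<le> (1 - \<beta>) * r" using r by (simp add: algebra_simps)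
  then have c: "\<bar>c\<bar> = (1 - \<beta>) * r" using r \<beta> by (simp add: c_def)
  have far: "\<bar>fst x + c - fst z\<bar> \<ge> 2 * (\<beta> * r)"
  proof (cases "fst x \<ge> fst z")
    case True
    then show ?thesis using b2 unfolding c_def by simp
  next
    case False
    then show ?thesis using b2 unfolding c_def by simp
  qed
  have "d (shift x c) x + \<beta> * r \<le> r"
    using cover_dist_shift_le[OF x, of c "(1 - \<beta>) * r"] c by (simp add: cover.commute algebra_simps)
  then have "cover_cball P (shift x c) (\<beta> * r) \<subseteq> cover_cball P x r"
    using x by (rule cover.mcball_subset)
  moreover have "y \<notin> cylinder P z (\<beta> * r) i" if "y \<in> cover_cball P (shift x c) (\<beta> * r)" for y
  proof -
    have "place_dist 0 (shift x c) y \<le> \<beta> * r"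
      using that mem_cball_iff[of "shift x c" y "\<beta> * r"] x by simp
    then have "\<bar>fst x + c - fst y\<bar> \<le> \<beta> * r" by (simp add: place_dist_def shift_def)
    then have "\<not> \<bar>fst y - fst z\<bar> < \<beta> * r" using far by linarith
    then show ?thesis using True mem_cylinder[OF i, of y z "\<beta> * r"] by (simp add: place_dist_def)
  qed
  ultimately show ?thesis using x by (intro bexI[of _ "shift x c"]) auto
next
  case False
  then have iP: "i \<in> P" using i by simp
  have br: "\<beta> * r \<le> r" using \<beta> r by simp
  show ?thesis
  proof (cases "place_dist i x z > \<beta> * r")
    case True
    have "y \<notin> cylinder P z (\<beta> * r) i" if y: "y \<in> cover_cball P x (\<beta> * r)" for y
      using y place_dist_ultra[OF iP x _ z, of y] True mem_cball_iff[OF x, of y "\<beta> * r"]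
        mem_cylinder[OF i, of y z "\<beta> * r"] i by auto
    then show ?thesis
      using cover.mcball_subset_concentric[OF br, of x] x by (intro bexI[of _ x]) auto
  next
    case near: False
    interpret Q: cring "Qp i" by (rule Qp_cring[OF iP])
    have i1: "real i > 1" using prime_gt_1_nat[OF prime[OF iP]] by simp
    \<comment> \<open>\<open>real i powi k\<close> is the largest value of the weighted distance
      that is at most \<open>r\<close>. Adding \<open>v\<close>, of absolute value
      \<open>real i powi (k + 1)\<close>, moves the centre by exactly this much at place
      \<open>i\<close>. It exceeds \<open>\<beta> * r\<close> because \<open>r\<close> is below the
      next power and \<open>\<beta> * real i < 1\<close>.\<close>
    define k where "k = \<lfloor>log (real i) r\<rfloor>"
    have "real i powr (real_of_int k) \<le> r" "r < real i powr (real_of_int k + 1)"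
      using i1 r by (auto simp: k_def powr_le_iff less_powr_iff le_log_iff floor_less_iff)
    then have k: "real i powi k \<le> r" "r < real i powi k * real i"
      using i1 by (auto simp: powr_real_of_int' powr_add)
    define v where "v = padic_of_rat i (of_nat i powi (- (k + 1)))"
    have v: "v \<in> carrier (Qp i)" "padic_abs i v = real i powi (k + 1)"
      using prime[OF iP] by (auto simp: v_def padic_abs_rat_power_self add.commute)
    define x' where "x' = (fst x, (snd x)(i := snd x i \<oplus>\<^bsub>Qp i\<^esub> v))"
    have x': "x' \<in> X"
    proof -
      have "{p\<in>P. snd x' p \<notin> Zp p} \<subseteq> insert i {p\<in>P. snd x p \<notin> Zp p}" by (auto simp: x'_def)
      moreover have "finite (insert i {p\<in>P. snd x p \<notin> Zp p})" using x by (simp add: mem_cover_iff)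
      ultimately have "finite {p\<in>P. snd x' p \<notin> Zp p}" by (rule finite_subset)
      then show ?thesis
        using x iP v cover_coord[OF x iP] by (auto simp: mem_cover_iff x'_def PiE_iff extensional_def)
    qed
    have other: "place_dist j x y = place_dist j x' y" if "j \<noteq> i" for j y
      using that by (simp add: place_dist_def x'_def)
    have "snd x' i \<ominus>\<^bsub>Qp i\<^esub> snd x i = v"
      using v cover_coord[OF x iP] by (simp add: x'_def) algebra
    then have dist: "place_dist i x' x = real i powi k"
      using False v i1 by (simp add: place_dist_def power_int_add)
    have "\<beta> * r < real i powi k"
    proof -
      have "\<beta> * r < \<beta> * (real i powi k * real i)" using k \<beta> by simp
      also have "\<dots> = (\<beta> * real i) * real i powi k" by simp
      also have "\<dots> < 1 * real i powi k" using \<beta>(3) i1 by (intro mult_strict_right_mono) auto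
      finally show ?thesis by simp
    qed
    then have far: "place_dist i x' x > \<beta> * r" using dist by simp
    have "y \<in> cover_cball P x r - cylinder P z (\<beta> * r) i" if y: "y \<in> cover_cball P x' (\<beta> * r)" for y
    proof -
      have yX: "y \<in> X" using y by simp
      have le: "place_dist j x' y \<le> \<beta> * r" if "j \<in> places" for j
        using y mem_cball_iff[OF x' yX] that by blast
      have "place_dist i x y \<le> r"
        using place_dist_ultra[OF iP x x' yX] le[OF i] br dist k place_dist_commute[OF i x x'] by simp
      then have "place_dist j x y \<le> r" if "j \<in> places" for j
        using other[of j y] le[OF that] br by (cases "j = i") auto
      then have "y \<in> cover_cball P x r" using mem_cball_iff[OF x yX] by blast
      moreover have "y \<notin> cylinder P z (\<beta> * r) i"
      proof
        assume "y \<in> cylinder P z (\<beta> * r) i"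
        then have "place_dist i y z < \<beta> * r" using mem_cylinder[OF i] by blast
        then have "place_dist i x' z \<le> \<beta> * r" using place_dist_ultra[OF iP x' yX z] le[OF i] by simp
        moreover have "place_dist i z x \<le> \<beta> * r" using near place_dist_commute[OF i x z] by simp
        ultimately show False using place_dist_ultra[OF iP x' z x] far by simp
      qed
      ultimately show ?thesis by blast
    qed
    then show ?thesis using x' by blast
  qed
qed

text \<open>The centres converge in each coordinate separately. The point needing care is that the
  limit satisfies the restricted product condition.\<close>

lemma nested_cballs_nonempty:
  fixes x :: "nat \<Rightarrow> cover_pt"
  assumes x: "\<And>l. x l \<in> X" and pos: "\<And>l. \<rho> l > 0" and lim: "\<rho> \<longlonglongrightarrow> 0"
    and nest: "\<And>l. cover_cball P (x (Suc l)) (\<rho> (Suc l)) \<subseteq> cover_cball P (x l) (\<rho> l)"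
  shows "\<exists>z\<in>X. \<forall>l. z \<in> cover_cball P (x l) (\<rho> l)"
proof -
  have sub: "cover_cball P (x m) (\<rho> m) \<subseteq> cover_cball P (x l) (\<rho> l)" if "l \<le> m" for l m
    using that
  proof (induction m rule: dec_induct)
    case (step m)
    then show ?case using nest[of m] by blast
  qed simp
  have le: "place_dist i (x l) (x m) \<le> \<rho> l" if "i \<in> places" "l \<le> m" for i l m
  proof -
    have "x m \<in> cover_cball P (x m) (\<rho> m)" using x pos[of m] by (simp add: less_imp_le)
    then show ?thesis using sub[OF that(2)] mem_cball_iff[OF x x, of m l "\<rho> l"] that(1) by blast
  qed
  have cau: "\<exists>N. \<forall>m\<ge>N. \<forall>n\<ge>N. place_dist i (x m) (x n) < e" if i: "i \<in> places" and e: "e > 0" for i e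
  proof -
    obtain N where N: "\<forall>n\<ge>N. \<rho> n < e"
      using order_tendstoD(2)[OF lim e] by (auto simp: eventually_sequentially)
    have "place_dist i (x m) (x n) < e" if "m \<ge> N" "n \<ge> N" for m n
    proof (cases "m \<le> n")
      case True
      then show ?thesis using le[OF i True] N that by force
    next
      case False
      then have "place_dist i (x n) (x m) < e" using le[OF i, of n m] N that by force
      then show ?thesis using place_dist_commute[OF i x x] by simp
    qed
    then show ?thesis by blast
  qed
  have "Cauchy (\<lambda>n. fst (x n))"
    using cau[of 0] by (intro CauchyI) (simp add: place_dist_def)
  then obtain c where c: "(\<lambda>n. fst (x n)) \<longlonglongrightarrow> c"
    using real_Cauchy_convergent by (auto simp: convergent_def)
  have "\<exists>v\<in>carrier (Qp p). (\<lambda>n. padic_abs p (snd (x n) p \<ominus>\<^bsub>Qp p\<^esub> v)) \<longlonglongrightarrow> 0" if p: "p \<in> P" for p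
  proof -
    have "\<exists>N. \<forall>m\<ge>N. \<forall>n\<ge>N. padic_abs p (snd (x m) p \<ominus>\<^bsub>Qp p\<^esub> snd (x n) p) < e" if "e > 0" for e
    proof -
      have "e / real p > 0" using that P_pos[OF p] by simp
      then obtain N where "\<forall>m\<ge>N. \<forall>n\<ge>N. place_dist p (x m) (x n) < e / real p"
        using cau[OF insertI2[OF p]] by blast
      then have "\<forall>m\<ge>N. \<forall>n\<ge>N. padic_abs p (snd (x m) p \<ominus>\<^bsub>Qp p\<^esub> snd (x n) p) < e"
        using P_pos[OF p] by (simp add: place_dist_def divide_less_cancel)
      then show ?thesis by blast
    qed
    from Qp_complete[OF prime[OF p] cover_coord[OF x p] this] show ?thesis by blast
  qed
  then have "\<exists>v. \<forall>p\<in>P. v p \<in> carrier (Qp p) \<and>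
      (\<lambda>n. padic_abs p (snd (x n) p \<ominus>\<^bsub>Qp p\<^esub> v p)) \<longlonglongrightarrow> 0"
    by (intro bchoice) blast
  then obtain v where v: "\<And>p. p \<in> P \<Longrightarrow> v p \<in> carrier (Qp p)"
    and vlim: "\<And>p. p \<in> P \<Longrightarrow> (\<lambda>n. padic_abs p (snd (x n) p \<ominus>\<^bsub>Qp p\<^esub> v p)) \<longlonglongrightarrow> 0"
    by blast
  have vle: "padic_abs p (snd (x l) p \<ominus>\<^bsub>Qp p\<^esub> v p) \<le> real p * \<rho> l" if p: "p \<in> P" for p l
  proof -
    have "(\<lambda>m. max (real p * \<rho> l) (padic_abs p (snd (x m) p \<ominus>\<^bsub>Qp p\<^esub> v p))) \<longlonglongrightarrow> max (real p * \<rho> l) 0"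
      by (intro tendsto_max tendsto_const vlim p)
    moreover have "padic_abs p (snd (x l) p \<ominus>\<^bsub>Qp p\<^esub> v p) \<le>
        max (real p * \<rho> l) (padic_abs p (snd (x m) p \<ominus>\<^bsub>Qp p\<^esub> v p))" if "m \<ge> l" for m
    proof -
      have "padic_abs p (snd (x l) p \<ominus>\<^bsub>Qp p\<^esub> snd (x m) p) \<le> real p * \<rho> l"
        using le[of p l m] p that P_pos[OF p] by (simp add: place_dist_def field_simps)
      then show ?thesis
        using padic_abs_triangle_max[OF prime[OF p] cover_coord[OF x[of l] p] cover_coord[OF x[of m] p] v[OF p]]
        by linarith
    qed
    ultimately have "padic_abs p (snd (x l) p \<ominus>\<^bsub>Qp p\<^esub> v p) \<le> max (real p * \<rho> l) 0"
      by (intro LIMSEQ_le_const) auto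
    then show ?thesis using pos[of l] by simp
  qed
  define z where "z = (c, \<lambda>p\<in>P. v p)"
  \<comment> \<open>From a radius below 1 on, the limit differs from the centre by less than
    \<open>p\<close> in absolute value at every prime \<open>p\<close>, hence by at most 1. So it is
    integral wherever the single point \<open>x N\<close> is.\<close>
  obtain N where N: "\<rho> N < 1"
    using order_tendstoD(2)[OF lim zero_less_one] by (auto simp: eventually_sequentially)
  have z: "z \<in> X"
    unfolding z_def
  proof (rule mem_coverI[OF x[of N] x[of N]])
    fix p assume p: "p \<in> P"
    interpret Q: cring "Qp p" by (rule Qp_cring[OF p])
    show "v p \<in> carrier (Qp p)" using v p by blast
    assume xN: "snd (x N) p \<in> Zp p"
    have "padic_abs p (snd (x N) p \<ominus>\<^bsub>Qp p\<^esub> v p) < real p"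
    proof -
      have "real p * \<rho> N < real p * 1" using N P_pos[OF p] by (intro mult_strict_left_mono) auto
      then show ?thesis using vle[OF p, of N] by simp
    qed
    then have "padic_abs p (snd (x N) p \<ominus>\<^bsub>Qp p\<^esub> v p) \<le> 1"
      using v[OF p] cover_coord[OF x p] by (intro padic_abs_lt_self prime p) auto
    then have "snd (x N) p \<ominus>\<^bsub>Qp p\<^esub> v p \<in> Zp p" using v[OF p] cover_coord[OF x p] by (simp add: Zp_def)
    then have "snd (x N) p \<ominus>\<^bsub>Qp p\<^esub> (snd (x N) p \<ominus>\<^bsub>Qp p\<^esub> v p) \<in> Zp p"
      by (rule Zp_diff[OF prime[OF p] xN])
    moreover have "snd (x N) p \<ominus>\<^bsub>Qp p\<^esub> (snd (x N) p \<ominus>\<^bsub>Qp p\<^esub> v p) = v p"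
      using v[OF p] cover_coord[OF x[of N] p] by algebra
    ultimately show "v p \<in> Zp p" by (simp only:)
  qed
  have "place_dist i (x l) z \<le> \<rho> l" if i: "i \<in> places" for i l
  proof (cases "i = 0")
    case True
    have "(\<lambda>m. \<bar>fst (x l) - fst (x m)\<bar>) \<longlonglongrightarrow> \<bar>fst (x l) - c\<bar>"
      by (intro tendsto_intros c)
    moreover have "\<forall>m\<ge>l. \<bar>fst (x l) - fst (x m)\<bar> \<le> \<rho> l"
      using le[of 0 l] by (simp add: place_dist_def)
    ultimately have "\<bar>fst (x l) - c\<bar> \<le> \<rho> l" by (intro LIMSEQ_le_const2) auto
    then show ?thesis using True by (simp add: place_dist_def z_def)
  next
    case False
    then have "i \<in> P" using i by simp
    then show ?thesis using vle[of i l] P_pos[of i] by (simp add: place_dist_def z_def field_simps)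
  qed
  then have "z \<in> cover_cball P (x l) (\<rho> l)" for l
    using mem_cball_iff[OF x z, of l "\<rho> l"] by blast
  then show ?thesis using z by blast
qed

end

section \<open>Shrinking radii and the numbering of turns\<close>

lemma tendsto_0_if_halving:
  fixes \<rho> :: "nat \<Rightarrow> real"
  assumes pos: "\<And>n. 0 < \<rho> n" and dec: "\<And>n. \<rho> (Suc n) \<le> \<rho> n"
    and half: "\<And>n. \<rho> (Suc (2 * n)) \<le> \<rho> (2 * n) / 2"
  shows "\<rho> \<longlonglongrightarrow> 0"
proof (rule LIMSEQ_I)
  fix e :: real assume e: "e > 0"
  have h: "\<rho> (2 * n) \<le> \<rho> 0 * (1/2) ^ n" for n
  proof (induction n)
    case (Suc n)
    have "\<rho> (2 * Suc n) \<le> \<rho> (2 * n) / 2"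
      using dec[of "Suc (2 * n)"] half[of n] by simp
    then show ?case using Suc by simp
  qed simp
  have "(\<lambda>n. \<rho> 0 * (1/2) ^ n) \<longlonglongrightarrow> \<rho> 0 * 0"
    by (intro tendsto_mult tendsto_const LIMSEQ_realpow_zero) auto
  then have "\<forall>\<^sub>F n in sequentially. \<rho> 0 * (1/2) ^ n < e"
    using e by (intro order_tendstoD(2)) auto
  then obtain n where n: "\<rho> 0 * (1/2) ^ n < e" by (auto simp: eventually_sequentially)
  have "norm (\<rho> m - 0) < e" if "m \<ge> 2 * n" for m
  proof -
    have "\<rho> m \<le> \<rho> (2 * n)" using that dec by (rule lift_Suc_antimono_le[rotated])
    then show ?thesis using h[of n] n pos[of m] by simp
  qed
  then show "\<exists>N. \<forall>n\<ge>N. norm (\<rho> n - 0) < e" by blast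
qed

lemma multiplicity_2_pow_times_odd: "multiplicity (2::nat) (2 ^ \<tau> * (2 * n + 1)) = \<tau>"
proof (rule multiplicity_eqI)
  have "2 ^ Suc \<tau> = (2::nat) ^ \<tau> * 2" by simp
  then show "\<not> 2 ^ Suc \<tau> dvd (2::nat) ^ \<tau> * (2 * n + 1)"
    by (simp only: dvd_mult_cancel1 power_not_zero nat_mult_dvd_cancel_disj) simp
qed simp

context prime_set
begin

section \<open>Winning countably many games at once\<close>

text \<open>If Alice is given a turn at balls of radii \<open>\<rho> 0, \<rho> 1, \<dots>\<close>, consecutive ones of which
  shrink at most by the factor \<open>D\<close>, then one cylinder at each of these turns is enough to keep
  the outcome of the game in \<open>G\<close>. The slower the turns, the larger \<open>D\<close> is, so that Alice
  can serve countably many such sets in parallel.\<close>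

definition manages ::
    "real \<Rightarrow> nat set \<Rightarrow> cover_pt set \<Rightarrow> real \<Rightarrow> real \<Rightarrow> (real \<Rightarrow> real \<Rightarrow> cover_pt set) \<Rightarrow> bool" where
  "manages \<beta> Q G D \<rho>0 V \<longleftrightarrow>
     (\<forall>a b. \<forall>x\<in>X. 0 < b \<and> a \<le> D * b \<longrightarrow>
        (\<exists>z\<in>X. \<exists>i\<in>insert 0 Q. V a b \<inter> cover_cball P x b \<subseteq> cylinder P z (\<beta> * b) i)) \<and>
     (\<forall>\<rho> :: nat \<Rightarrow> real. \<rho> 0 = \<rho>0 \<and> (\<forall>n. 0 < \<rho> n) \<and> \<rho> \<longlonglongrightarrow> 0 \<longrightarrow>
        X - G \<subseteq> (\<Union>n. V (\<rho> n) (\<rho> (Suc n))))"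

text \<open>\<open>D\<close> comes from the period of the task and \<open>\<rho>0\<close> from the
  radius at its first turn, which is known only during the play; the sets \<open>V\<close> may
  depend on both.\<close>

definition manageable :: "real \<Rightarrow> nat set \<Rightarrow> cover_pt set \<Rightarrow> bool" where
  "manageable \<beta> Q G \<longleftrightarrow> (\<forall>D>0. \<forall>\<rho>0>0. \<exists>V. manages \<beta> Q G D \<rho>0 V)"

theorem winning_strategy_manageable:
  fixes G :: "nat \<Rightarrow> cover_pt set"
  assumes Q: "Q \<subseteq> P" and \<beta>: "0 < \<beta>" "\<beta> \<le> 1/3" "\<And>q. q \<in> Q \<Longrightarrow> \<beta> * real q < 1"
    and G: "\<And>n. manageable \<beta> Q (G n)"
    and F: "X \<inter> (\<Inter>n. G n) \<subseteq> F"
  shows "\<exists>\<sigma>. winning_strategy P \<beta> F \<sigma>"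
proof -
  let ?rad = "ball_radius P"
  \<comment> \<open>Successive turns of task \<open>\<tau>\<close> are \<open>2 ^ Suc \<tau>\<close>
    moves apart, and Bob shrinks the radius at most by the factor \<open>\<beta>\<close> in each
    move.\<close>
  define D where "D \<tau> = 1 / \<beta> ^ (2 ^ Suc \<tau>)" for \<tau> :: nat
  have D: "D \<tau> > 0" for \<tau> using \<beta> by (simp add: D_def)
  have "\<forall>\<tau> \<rho>0. \<exists>V. \<rho>0 > 0 \<longrightarrow> manages \<beta> Q (G (\<tau> - 1)) (D \<tau>) \<rho>0 V"
    using G D unfolding manageable_def by blast
  then obtain V where V: "\<And>\<tau> \<rho>0. \<rho>0 > 0 \<Longrightarrow> manages \<beta> Q (G (\<tau> - 1)) (D \<tau>) \<rho>0 (V \<tau> \<rho>0)"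
    by metis
  have V1: "\<exists>z\<in>X. \<exists>i\<in>insert 0 Q. V \<tau> \<rho>0 a b \<inter> cover_cball P x b \<subseteq> cylinder P z (\<beta> * b) i"
    if "\<rho>0 > 0" "x \<in> X" "0 < b" "a \<le> D \<tau> * b" for \<tau> \<rho>0 a b x
    using V[OF that(1), of \<tau>] that(2-) unfolding manages_def by simp
  have V2: "X - G (\<tau> - 1) \<subseteq> (\<Union>n. V \<tau> \<rho>0 (\<rho> n) (\<rho> (Suc n)))"
    if "\<rho>0 > 0" "\<rho> 0 = \<rho>0" "\<And>n. 0 < \<rho> n" "\<rho> \<longlonglongrightarrow> 0" for \<tau> \<rho>0 and \<rho> :: "nat \<Rightarrow> real"
    using V[OF that(1), of \<tau>] that(2-) unfolding manages_def by simp

  text \<open>The turn with number \<open>l\<close> (counted from 0) belongs to task \<open>\<tau>\<close>, the exponent of 2 in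
    \<open>l + 1\<close>, so task \<open>\<tau>\<close> has period \<open>2 ^ (\<tau> + 1)\<close>. Task 0 halves the radius by a cylinder
    around the centre of the ball; task \<open>\<tau> > 0\<close> takes care of \<open>G (\<tau> - 1)\<close>.\<close>

  define good where "good Bs C \<longleftrightarrow>
    (let \<tau> = multiplicity 2 (length Bs); l = length Bs - 1; b = ?rad (last Bs) in
      (\<exists>z\<in>X. \<exists>i\<in>insert 0 Q. C = cylinder P z (\<beta> * b) i) \<and>
      (\<tau> = 0 \<longrightarrow> (\<exists>x\<in>X. last Bs = cover_cball P x b \<and> C = cylinder P x (\<beta> * b) 0)) \<and>
      (\<tau> > 0 \<and> 2 ^ Suc \<tau> \<le> l \<and> ?rad (Bs ! (2 ^ \<tau> - 1)) > 0 \<and>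
        ?rad (Bs ! (l - 2 ^ Suc \<tau>)) \<le> D \<tau> * b \<longrightarrow>
        V \<tau> (?rad (Bs ! (2 ^ \<tau> - 1))) (?rad (Bs ! (l - 2 ^ Suc \<tau>))) b \<inter> last Bs \<subseteq> C))"
    for Bs C
  define \<sigma> where "\<sigma> Bs = (SOME C. good Bs C)" for Bs
  \<comment> \<open>The guards in the last clause of \<open>good\<close> make it satisfiable for
    every list ending in a closed ball, whether or not it is a history. The bound on
    \<open>l\<close> also exempts the first turn of a task, at \<open>l = 2 ^ \<tau> - 1\<close>:
    that turn only supplies the initial radius, which the strategy reads off the history
    later.\<close>
  have "\<exists>C. good Bs C" if cb: "closed_ball P (last Bs)" for Bs
  proof -
    obtain x where x: "x \<in> X" "?rad (last Bs) > 0" "last Bs = cover_cball P x (?rad (last Bs))"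
      using closed_ballE[OF cb] by blast
    define \<tau> where "\<tau> = multiplicity 2 (length Bs)"
    define l where "l = length Bs - 1"
    show ?thesis
    proof (cases "\<tau> > 0 \<and> 2 ^ Suc \<tau> \<le> l \<and> ?rad (Bs ! (2 ^ \<tau> - 1)) > 0 \<and>
        ?rad (Bs ! (l - 2 ^ Suc \<tau>)) \<le> D \<tau> * ?rad (last Bs)")
      case True
      then obtain z i where zi: "z \<in> X" "i \<in> insert 0 Q"
        and sub: "V \<tau> (?rad (Bs ! (2 ^ \<tau> - 1))) (?rad (Bs ! (l - 2 ^ Suc \<tau>))) (?rad (last Bs)) \<inter> last Bs
          \<subseteq> cylinder P z (\<beta> * ?rad (last Bs)) i"
        using V1[of "?rad (Bs ! (2 ^ \<tau> - 1))" x "?rad (last Bs)" "?rad (Bs ! (l - 2 ^ Suc \<tau>))" \<tau>] x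
        by metis
      show ?thesis
        unfolding good_def Let_def \<tau>_def[symmetric] l_def[symmetric]
      proof (intro exI conjI impI)
        show "\<exists>z'\<in>X. \<exists>i'\<in>insert 0 Q. cylinder P z (\<beta> * ?rad (last Bs)) i =
            cylinder P z' (\<beta> * ?rad (last Bs)) i'"
          using zi by blast
      qed (use True sub in simp_all)
    next
      case False
      show ?thesis
        unfolding good_def Let_def \<tau>_def[symmetric] l_def[symmetric]
      proof (intro exI conjI impI)
        show "\<exists>z'\<in>X. \<exists>i'\<in>insert 0 Q. cylinder P x (\<beta> * ?rad (last Bs)) 0 =
            cylinder P z' (\<beta> * ?rad (last Bs)) i'"
          using x by blast
        show "\<exists>y\<in>X. last Bs = cover_cball P y (?rad (last Bs)) \<and>
            cylinder P x (\<beta> * ?rad (last Bs)) 0 = cylinder P y (\<beta> * ?rad (last Bs)) 0"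
          using x by blast
      qed (use False in blast)
    qed
  qed
  then have \<sigma>: "good Bs (\<sigma> Bs)" if "closed_ball P (last Bs)" for Bs
    unfolding \<sigma>_def using that someI_ex by metis
  have history_ball: "closed_ball P (Bs ! j)" if "bob_history P \<beta> \<sigma> Bs" "j < length Bs" for Bs j
    using that by (cases j) (auto simp: bob_history_def bob_legal_def)
  have legal: "alice_legal P \<beta> (last Bs) (\<sigma> Bs) \<and> (\<exists>B'. bob_legal P \<beta> (last Bs) (\<sigma> Bs) B')"
    if h: "bob_history P \<beta> \<sigma> Bs" for Bs
  proof -
    have "Bs \<noteq> []" using h by (simp add: bob_history_def)
    then have cb: "closed_ball P (last Bs)" using history_ball[OF h] by (simp add: last_conv_nth)
    define b where "b = ?rad (last Bs)"
    obtain x where x: "x \<in> X" "b > 0" "last Bs = cover_cball P x b"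
      using closed_ballE[OF cb] unfolding b_def by blast
    obtain z i where C: "z \<in> X" "i \<in> insert 0 Q" "\<sigma> Bs = cylinder P z (\<beta> * b) i"
      using \<sigma>[OF cb] unfolding good_def Let_def b_def by blast
    have i: "i \<in> places" "\<beta> * real i < 1" using C(2) Q \<beta>(3) by auto
    have bb: "\<beta> * b > 0" using \<beta> x by simp
    have "alice_legal P \<beta> (last Bs) (\<sigma> Bs)"
      unfolding alice_legal_def b_def[symmetric] C(3)
      using C(1) i bb cylinder_radius_le[OF bb] by blast
    moreover obtain x' where x': "x' \<in> X" "cover_cball P x' (\<beta> * b) \<subseteq> cover_cball P x b - cylinder P z (\<beta> * b) i"
      using exists_ball_avoiding_cylinder[OF x(1,2) C(1) i(1) \<beta>(1,2) i(2)] by blast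
    have "bob_legal P \<beta> (last Bs) (\<sigma> Bs) (cover_cball P x' (\<beta> * b))"
      unfolding bob_legal_def b_def[symmetric] C(3)
      using x' bb ball_radius_cball[OF x'(1) bb] x(3) by (auto simp: closed_ball_def)
    ultimately show ?thesis by blast
  qed
  have wins: "(\<Inter>j. B j) \<inter> F \<noteq> {}" if h: "\<forall>j. bob_history P \<beta> \<sigma> (map B [0..<Suc j])"
    for B :: "nat \<Rightarrow> cover_pt set"
  proof -
    define \<rho> where "\<rho> l = ?rad (B l)" for l
    define C where "C l = \<sigma> (map B [0..<Suc l])" for l
    have len: "length (map B [0..<Suc l]) = Suc l" "last (map B [0..<Suc l]) = B l" for l
      by simp_all
    have nth: "map B [0..<Suc l] ! j = B j" if "j \<le> l" for l j
      using that by (simp del: upt_Suc add: nth_append)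
    have cb: "closed_ball P (B l)" for l
      using history_ball[OF h[rule_format, of l], of l] nth[of l l] by simp
    have "bob_legal P \<beta> (B l) (C l) (B (Suc l))" for l
    proof -
      have "take (Suc l) (map B [0..<Suc (Suc l)]) = map B [0..<Suc l]"
        by (simp add: take_map del: upt_Suc)
      moreover have "Suc l < length (map B [0..<Suc (Suc l)])" by simp
      ultimately show ?thesis
        using h[rule_format, of "Suc l"] nth[of l "Suc l"] nth[of "Suc l" "Suc l"]
        unfolding bob_history_def C_def by (metis le_SucI order_refl)
    qed
    then have step: "B (Suc l) \<subseteq> B l - C l" "\<rho> (Suc l) \<ge> \<beta> * \<rho> l" for l
      by (simp_all add: bob_legal_def \<rho>_def)
    have "\<forall>l. \<exists>x. x \<in> X \<and> \<rho> l > 0 \<and> B l = cover_cball P x (\<rho> l)"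
      using closed_ballE[OF cb] unfolding \<rho>_def by metis
    then obtain x where x: "\<And>l. x l \<in> X" and pos: "\<And>l. \<rho> l > 0" and B: "\<And>l. B l = cover_cball P (x l) (\<rho> l)"
      by metis
    have good: "good (map B [0..<Suc l]) (C l)" for l
      unfolding C_def using \<sigma>[of "map B [0..<Suc l]"] cb[of l] len by metis
    have sub: "cover_cball P (x (Suc l)) (\<rho> (Suc l)) \<subseteq> cover_cball P (x l) (\<rho> l)" for l
      using step(1)[of l] B by blast
    have dec: "\<rho> (Suc l) \<le> \<rho> l" for l
      using cball_subset_real[OF x x pos sub, of l] by linarith
    \<comment> \<open>Bob's new ball misses a real cylinder about the centre \<open>y\<close>, so
      its projection to the real line is an interval avoiding \<open>fst y\<close>. It fits on one
      side of the centre, where only half of the length is left.\<close>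
    have half: "\<rho> (Suc (2 * n)) \<le> \<rho> (2 * n) / 2" for n
    proof -
      let ?l = "2 * n"
      have "multiplicity 2 (Suc ?l) = 0" by (intro not_dvd_imp_multiplicity_0) auto
      then obtain y where y: "y \<in> X" "B ?l = cover_cball P y (\<rho> ?l)" "C ?l = cylinder P y (\<beta> * \<rho> ?l) 0"
        using good[of ?l] unfolding good_def Let_def len \<rho>_def by blast
      have far: "\<bar>fst (x (Suc ?l)) - fst y\<bar> + \<rho> (Suc ?l) \<le> \<rho> ?l"
        using cball_subset_real[OF y(1) x pos, of "Suc ?l"] step(1)[of ?l] y(2) B by blast
      have "\<rho> (Suc ?l) \<le> \<bar>fst (x (Suc ?l)) - fst y\<bar>"
      proof (rule ccontr)
        assume n: "\<not> ?thesis"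
        define w where "w = shift (x (Suc ?l)) (fst y - fst (x (Suc ?l)))"
        have "d (x (Suc ?l)) w \<le> \<rho> (Suc ?l)"
          unfolding w_def using x n by (intro cover_dist_shift_le) auto
        then have "w \<in> B (Suc ?l)" using x unfolding B by (simp add: w_def)
        moreover have "w \<in> C ?l"
        proof -
          have "w \<in> X" using x by (simp add: w_def)
          moreover have "place_dist 0 w y = 0" by (simp add: w_def place_dist_def shift_def)
          ultimately show ?thesis
            using mem_cylinder[of 0 w y "\<beta> * \<rho> ?l"] pos[of ?l] \<beta> unfolding y(3) by simp
        qed
        ultimately show False using step(1) by blast
      qed
      then show ?thesis using far by simp
    qed
    have lim: "\<rho> \<longlonglongrightarrow> 0" using tendsto_0_if_halving[of \<rho>, OF pos dec half] .
    obtain z where z: "z \<in> X" and "\<forall>l. z \<in> cover_cball P (x l) (\<rho> l)"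
      using nested_cballs_nonempty[of x \<rho>, OF x pos lim sub] by blast
    then have zB: "z \<in> B l" for l using B by blast
    have "z \<in> G t" for t
    proof (rule ccontr)
      assume zG: "z \<notin> G t"
      define \<tau> where "\<tau> = Suc t"
      \<comment> \<open>The turns of task \<open>\<tau>\<close>: a history that ends with ball
        number \<open>l\<close> has length \<open>l + 1\<close>, whence the subtraction of
        1.\<close>
      define l where "l n = 2 ^ \<tau> * (2 * n + 1) - 1" for n :: nat
      have Suc_l: "Suc (l n) = 2 ^ \<tau> * (2 * n + 1)" for n by (simp add: l_def)
      have l_Suc: "l (Suc n) = l n + 2 ^ Suc \<tau>" for n
      proof -
        have "Suc (l (Suc n)) = Suc (l n) + 2 ^ Suc \<tau>"
          unfolding Suc_l by (simp add: algebra_simps)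
        then show ?thesis by simp
      qed
      have "filterlim l at_top sequentially"
        by (rule filterlim_subseq) (simp add: strict_mono_Suc_iff l_Suc)
      then have lim': "(\<lambda>n. \<rho> (l n)) \<longlonglongrightarrow> 0" using lim by (rule filterlim_compose[rotated])
      \<comment> \<open>The covering property is applied to the radii at the turns of this task
        alone. Some pair of consecutive turns catches \<open>z\<close>; at the later one Alice's
        cylinder contains \<open>z\<close>, although \<open>z\<close> also lies in Bob's next
        ball.\<close>
      have "z \<in> (\<Union>n. V \<tau> (\<rho> (l 0)) (\<rho> (l n)) (\<rho> (l (Suc n))))"
        using V2[OF pos[of "l 0"] refl pos lim', of \<tau>] zG z by (auto simp: \<tau>_def)
      then obtain n where n: "z \<in> V \<tau> (\<rho> (l 0)) (\<rho> (l n)) (\<rho> (l (Suc n)))" by blast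
      have shrink: "\<beta> ^ k * \<rho> m \<le> \<rho> (m + k)" for k m
      proof (induction k)
        case (Suc k)
        have "\<beta> ^ Suc k * \<rho> m = \<beta> * (\<beta> ^ k * \<rho> m)" by simp
        also have "\<dots> \<le> \<beta> * \<rho> (m + k)" using Suc \<beta> by (intro mult_left_mono) auto
        also have "\<dots> \<le> \<rho> (m + Suc k)" using step(2)[of "m + k"] by simp
        finally show ?case .
      qed simp
      have "\<rho> (l n) \<le> D \<tau> * \<rho> (l (Suc n))"
        using shrink[of "2 ^ Suc \<tau>" "l n"] \<beta> unfolding D_def l_Suc by (simp add: field_simps)
      moreover have "multiplicity 2 (Suc (l (Suc n))) = \<tau>" unfolding Suc_l by (rule multiplicity_2_pow_times_odd)
      moreover have "l 0 = 2 ^ \<tau> - 1" by (simp add: l_def)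
      moreover have "l (Suc n) - 2 ^ Suc \<tau> = l n" "2 ^ Suc \<tau> \<le> l (Suc n)" by (simp_all add: l_Suc)
      moreover have "l 0 \<le> l (Suc n)" "l n \<le> l (Suc n)"
        by (simp_all add: l_Suc) (simp add: l_def diff_le_mono)
      moreover have "0 < \<tau>" by (simp add: \<tau>_def)
      moreover have "\<rho> (l 0) > 0" by (rule pos)
      ultimately have "V \<tau> (\<rho> (l 0)) (\<rho> (l n)) (\<rho> (l (Suc n))) \<inter> B (l (Suc n)) \<subseteq> C (l (Suc n))"
        using good[of "l (Suc n)"] nth[of "l 0" "l (Suc n)"] nth[of "l n" "l (Suc n)"]
        unfolding good_def Let_def len diff_Suc_1 \<rho>_def by metis
      then show False using n zB[of "l (Suc n)"] zB[of "Suc (l (Suc n))"] step(1)[of "l (Suc n)"] by blast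
    qed
    then have "z \<in> F" using F z by blast
    then show ?thesis using zB by blast
  qed
  show ?thesis unfolding winning_strategy_def using legal wins by blast
qed


section \<open>Orbits of expanding affine maps\<close>

text \<open>A cylinder centred at \<open>w\<close> deletes it at any turn whatever, so
  \<open>V\<close> can be constant.\<close>

lemma manageable_remove_point:
  assumes "w \<in> X" "0 < \<beta>"
  shows "manageable \<beta> Q (X - {w})"
proof -
  have "w \<in> cylinder P w (\<beta> * b) 0" if "0 < b" for b
    using assms that mem_cylinder[of 0 w w "\<beta> * b"] by (simp add: place_dist_def)
  then have "manages \<beta> Q (X - {w}) D \<rho>0 (\<lambda>_ _. {w})" for D \<rho>0
    using assms unfolding manages_def by blast
  then show ?thesis unfolding manageable_def by blast
qed

text \<open>The windows \<open>c < \<kappa> ^ k * a\<close>, \<open>\<kappa> ^ k * b \<le> c\<close> of two consecutive turns at balls of radii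
  \<open>a\<close> and \<open>b\<close> contain every \<open>k\<close> exactly once. If two points of one ball of radius \<open>b\<close> come
  \<open>\<epsilon>\<close>-close to \<open>Y\<close> at times \<open>k \<le> k'\<close> of that window, at \<open>y\<close> and \<open>y'\<close>, then
  \<open>(T ^^ (k' - k)) y\<close> is so close to \<open>y'\<close> that they coincide; pulling back along the most expanding
  place \<open>i0\<close>, one cylinder contains all these points.\<close>

theorem manageable_expanding:
  fixes T :: "cover_pt \<Rightarrow> cover_pt" and c :: "nat \<Rightarrow> real"
  assumes T: "\<And>x. x \<in> X \<Longrightarrow> T x \<in> X"
    and scale: "\<And>i x y. i \<in> places \<Longrightarrow> x \<in> X \<Longrightarrow> y \<in> X \<Longrightarrow>
      place_dist i (T x) (T y) = c i * place_dist i x y"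
    and c_le: "\<And>i. i \<in> places \<Longrightarrow> c i \<le> \<kappa>"
    and i0: "i0 \<in> insert 0 Q" "Q \<subseteq> P" "c i0 = \<kappa>" and \<kappa>: "\<kappa> > 1"
    and Y: "Y \<subseteq> X"
    and sep: "\<And>l. \<exists>\<delta>>0. \<forall>y\<in>Y. \<forall>y'\<in>Y. d ((T ^^ l) y) y' < \<delta> \<longrightarrow> (T ^^ l) y = y'"
    and \<beta>: "0 < \<beta>"
  shows "manageable \<beta> Q {z\<in>X. \<exists>\<epsilon>>0. \<forall>k. \<forall>y\<in>Y. \<epsilon> \<le> d ((T ^^ k) z) y}"
  unfolding manageable_def
proof (intro allI impI)
  fix D \<rho>0 :: real assume D0: "D > 0" and \<rho>0: "\<rho>0 > 0"
  have i0P: "i0 \<in> places" using i0 by blast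
  have Tk: "(T ^^ k) x \<in> X" if "x \<in> X" for k x using that T by (induction k) auto
  have scale0: "place_dist i0 ((T ^^ k) x) ((T ^^ k) y) = \<kappa> ^ k * place_dist i0 x y"
    if "x \<in> X" "y \<in> X" for k x y
    by (induction k) (use that scale[OF i0P] Tk i0(3) in auto)
  have "place_dist i (T x) (T y) \<le> \<kappa> * d x y" if "x \<in> X" "y \<in> X" "i \<in> places" for i x y
    using scale[OF that(3,1,2)] place_dist_le[OF that(3,1,2)] place_dist_nonneg[OF that(3,1,2)]
      mult_mono[OF c_le[OF that(3)] place_dist_le[OF that(3,1,2)]] \<kappa> by simp
  then have lip1: "d (T x) (T y) \<le> \<kappa> * d x y" if "x \<in> X" "y \<in> X" for x y
    using cover_dist_le_iff[OF T T] that by simp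
  have lip: "d ((T ^^ k) x) ((T ^^ k) y) \<le> \<kappa> ^ k * d x y" if "x \<in> X" "y \<in> X" for k x y
  proof (induction k)
    case (Suc k)
    have "d ((T ^^ Suc k) x) ((T ^^ Suc k) y) \<le> \<kappa> * d ((T ^^ k) x) ((T ^^ k) y)"
      using lip1 Tk that by simp
    also have "\<dots> \<le> \<kappa> * (\<kappa> ^ k * d x y)" using Suc \<kappa> by (intro mult_left_mono) auto
    finally show ?case by (simp add: mult.assoc)
  qed simp
  define E where "E = max D 1"
  have E: "E \<ge> D" "E \<ge> 1" by (simp_all add: E_def)
  \<comment> \<open>Two visits in one window are fewer than \<open>L\<close> steps apart, because
    their time difference \<open>l\<close> satisfies \<open>\<kappa> ^ l < E\<close>. Hence finitely
    many separation constants \<open>\<delta>' l\<close> suffice and have a positive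
    minimum.\<close>
  obtain L where L: "E < \<kappa> ^ L" using real_arch_pow[OF \<kappa>] by blast
  obtain \<delta>' where \<delta>': "\<And>l. \<delta>' l > 0"
    and sep': "\<And>l y y'. y \<in> Y \<Longrightarrow> y' \<in> Y \<Longrightarrow> d ((T ^^ l) y) y' < \<delta>' l \<Longrightarrow> (T ^^ l) y = y'"
    using sep by metis
  define \<delta> where "\<delta> = Min (\<delta>' ` {..L})"
  have \<delta>: "\<delta> > 0" using \<delta>' by (simp add: \<delta>_def)
  have \<delta>_le: "\<delta> \<le> \<delta>' l" if "l \<le> L" for l using that by (simp add: \<delta>_def)
  \<comment> \<open>\<open>C < \<rho>0\<close> places all times \<open>k\<close>, including 0, above
    the lower edge of the first window. Two points of one ball are at most \<open>2 * C\<close>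
    apart at the later time, which uses up half of \<open>\<delta>\<close>.\<close>
  define C where "C = min (\<rho>0 / 2) (\<delta> / 4)"
  have C: "C > 0" "C < \<rho>0" "4 * C \<le> \<delta>" using \<rho>0 \<delta> by (auto simp: C_def)
  \<comment> \<open>The first bound keeps the error \<open>(E + 1) * \<epsilon>\<close> of two
    visits within the other half of \<open>\<delta>\<close>; the second makes this error, pulled
    back to the ball, smaller than \<open>\<beta> * b\<close>.\<close>
  define \<epsilon> where "\<epsilon> = min (\<delta> / (2 * (E + 1))) (\<beta> * C / (E * (E + 1)))"
  have \<epsilon>: "\<epsilon> > 0" using \<delta> C \<beta> E by (simp add: \<epsilon>_def)
  have "\<epsilon> \<le> \<delta> / (2 * (E + 1))" "\<epsilon> \<le> \<beta> * C / (E * (E + 1))" by (simp_all add: \<epsilon>_def)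
  then have \<epsilon>1: "(E + 1) * \<epsilon> \<le> \<delta> / 2" and \<epsilon>2: "(E + 1) * \<epsilon> * E \<le> \<beta> * C"
    using E by (simp_all add: pos_le_divide_eq mult_ac)
  define V where "V a b = {z\<in>X. \<exists>k. C < \<kappa> ^ k * a \<and> \<kappa> ^ k * b \<le> C \<and> (\<exists>y\<in>Y. d ((T ^^ k) z) y < \<epsilon>)}"
    for a b
  have close: "place_dist i0 z z' < \<beta> * b"
    if b: "0 < b" "a \<le> D * b" and z: "z \<in> X" "z' \<in> X" "d z z' \<le> 2 * b" and kk: "k \<le> k'"
      and k: "C < \<kappa> ^ k * a" and k': "\<kappa> ^ k' * b \<le> C"
      and y: "y \<in> Y" "y' \<in> Y" "d ((T ^^ k) z) y < \<epsilon>" "d ((T ^^ k') z') y' < \<epsilon>"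
    for a b z z' k k' y y'
  proof -
    have yX: "y \<in> X" "y' \<in> X" using y Y by auto
    define l where "l = k' - k"
    have k'l: "k' = l + k" using kk by (simp add: l_def)
    have pk: "\<kappa> ^ k > 0" "\<kappa> ^ k' > 0" "\<kappa> ^ l > 0" using \<kappa> by simp_all
    have "\<kappa> ^ k * a \<le> \<kappa> ^ k * (E * b)"
      using b E pk by (intro mult_left_mono) (auto intro: order_trans mult_right_mono)
    then have Ck: "C < \<kappa> ^ k * (E * b)" using k by linarith
    then have "\<kappa> ^ k * b * \<kappa> ^ l < \<kappa> ^ k * b * E"
      using k' by (simp add: k'l power_add algebra_simps)
    then have lE: "\<kappa> ^ l < E" using b pk by (simp add: mult_less_cancel_left_pos)
    have "l \<le> L"
      using lE L \<kappa> by (metis less_trans less_imp_le nat_le_linear not_less power_increasing)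
    have Tl: "(T ^^ k') z = (T ^^ l) ((T ^^ k) z)" by (simp add: k'l funpow_add)
    have "d ((T ^^ k') z) ((T ^^ l) y) \<le> \<kappa> ^ l * d ((T ^^ k) z) y"
      unfolding Tl using lip Tk z yX by blast
    also have "\<dots> \<le> E * d ((T ^^ k) z) y" using lE by (intro mult_right_mono) auto
    also have "\<dots> < E * \<epsilon>" using y(3) E by simp
    finally have 1: "d ((T ^^ k') z) ((T ^^ l) y) < E * \<epsilon>" .
    have "d ((T ^^ k') z) ((T ^^ k') z') \<le> \<kappa> ^ k' * d z z'" using lip z by blast
    also have "\<dots> \<le> \<kappa> ^ k' * (2 * b)" using z pk by (intro mult_left_mono) auto
    finally have 2: "d ((T ^^ k') z) ((T ^^ k') z') \<le> 2 * C" using k' by simp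
    have "d ((T ^^ l) y) y' \<le> d ((T ^^ l) y) ((T ^^ k') z) + d ((T ^^ k') z) ((T ^^ k') z')
        + d ((T ^^ k') z') y'"
      using cover.triangle[of "(T ^^ l) y" "(T ^^ k') z" y'] cover.triangle[of "(T ^^ k') z" "(T ^^ k') z'" y']
        Tk z yX by (smt (verit))
    also have "\<dots> < E * \<epsilon> + 2 * C + \<epsilon>" using 1 2 y(4) by (simp add: cover.commute)
    also have "\<dots> = (E + 1) * \<epsilon> + 2 * C" by (simp add: algebra_simps)
    also have "\<dots> \<le> \<delta>" using \<epsilon>1 C by linarith
    also have "\<dots> \<le> \<delta>' l" using \<delta>_le \<open>l \<le> L\<close> by blast
    finally have eq: "(T ^^ l) y = y'" using sep' y by blast
    \<comment> \<open>Once the two targets coincide, the crude error \<open>2 * C\<close> is no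
      longer needed: both orbits are close to the same point \<open>y'\<close>, and only the term
      with \<open>\<epsilon>\<close> remains. Dividing by \<open>\<kappa> ^ k'\<close>, which
      exceeds \<open>C / (E * b)\<close>, finishes the estimate.\<close>
    have "\<kappa> ^ k' * place_dist i0 z z' = place_dist i0 ((T ^^ k') z) ((T ^^ k') z')"
      using scale0 z by simp
    also have "\<dots> \<le> place_dist i0 ((T ^^ k') z) y' + place_dist i0 y' ((T ^^ k') z')"
      using place_dist_triangle i0P Tk z yX by blast
    also have "\<dots> \<le> d ((T ^^ k') z) y' + d y' ((T ^^ k') z')"
      using place_dist_le i0P Tk z yX by (intro add_mono) blast+
    also have "\<dots> < (E + 1) * \<epsilon>" using 1 y(4) unfolding eq by (simp add: cover.commute algebra_simps)
    finally have 3: "\<kappa> ^ k' * place_dist i0 z z' < (E + 1) * \<epsilon>" .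
    have nn: "place_dist i0 z z' \<ge> 0" using place_dist_nonneg i0P z by blast
    have "\<kappa> ^ k * (E * b) \<le> \<kappa> ^ k' * (E * b)"
      using \<kappa> kk E b by (intro mult_right_mono power_increasing) auto
    then have "C * place_dist i0 z z' \<le> \<kappa> ^ k' * (E * b) * place_dist i0 z z'"
      using Ck nn by (intro mult_right_mono) auto
    also have "\<dots> = (\<kappa> ^ k' * place_dist i0 z z') * (E * b)" by simp
    also have "\<dots> < (E + 1) * \<epsilon> * (E * b)" using 3 E b by (intro mult_strict_right_mono) auto
    also have "\<dots> \<le> \<beta> * C * b"
      using mult_right_mono[OF \<epsilon>2, of b] b by (simp add: mult.assoc)
    finally have "C * place_dist i0 z z' < C * (\<beta> * b)" by (simp add: algebra_simps)
    then show ?thesis using C by simp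
  qed
  show "\<exists>V. manages \<beta> Q {z\<in>X. \<exists>\<epsilon>>0. \<forall>k. \<forall>y\<in>Y. \<epsilon> \<le> d ((T ^^ k) z) y} D \<rho>0 V"
    unfolding manages_def
  proof (intro exI[of _ V] conjI allI ballI impI)
    fix a b x assume x: "x \<in> X" and ab: "0 < b \<and> a \<le> D * b"
    show "\<exists>z\<in>X. \<exists>i\<in>insert 0 Q. V a b \<inter> cover_cball P x b \<subseteq> cylinder P z (\<beta> * b) i"
    proof (cases "V a b \<inter> cover_cball P x b = {}")
      case False
      then obtain z where z: "z \<in> V a b" "z \<in> cover_cball P x b" by blast
      have "z' \<in> cylinder P z (\<beta> * b) i0" if z': "z' \<in> V a b \<inter> cover_cball P x b" for z'
      proof -
        have zX: "z \<in> X" "z' \<in> X" using z z' by simp_all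
        obtain k y where k: "C < \<kappa> ^ k * a" "\<kappa> ^ k * b \<le> C" "y \<in> Y" "d ((T ^^ k) z) y < \<epsilon>"
          using z by (auto simp: V_def)
        obtain k' y' where k': "C < \<kappa> ^ k' * a" "\<kappa> ^ k' * b \<le> C" "y' \<in> Y" "d ((T ^^ k') z') y' < \<epsilon>"
          using z' by (auto simp: V_def)
        have "d x z \<le> b" "d x z' \<le> b" using z z' by simp_all
        then have dist: "d z z' \<le> 2 * b" "d z' z \<le> 2 * b"
          using cover.triangle[OF zX(1) x zX(2)] by (simp_all add: cover.commute)
        have "place_dist i0 z' z < \<beta> * b"
        proof (cases "k \<le> k'")
          case True
          then have "place_dist i0 z z' < \<beta> * b"
            using close[of b a z z' k k' y y'] ab zX dist k k' by blast
          then show ?thesis using place_dist_commute i0P zX by metis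
        next
          case False
          then show ?thesis using close[of b a z' z k' k y' y] ab zX dist k k' by auto
        qed
        then show ?thesis using mem_cylinder i0P zX by blast
      qed
      then show ?thesis using i0 z by (intro bexI[of _ z] bexI[of _ i0]) auto
    qed (use x in blast)
  next
    fix \<rho> :: "nat \<Rightarrow> real" assume \<rho>: "\<rho> 0 = \<rho>0 \<and> (\<forall>n. 0 < \<rho> n) \<and> \<rho> \<longlonglongrightarrow> 0"
    show "X - {z\<in>X. \<exists>\<epsilon>>0. \<forall>k. \<forall>y\<in>Y. \<epsilon> \<le> d ((T ^^ k) z) y} \<subseteq> (\<Union>n. V (\<rho> n) (\<rho> (Suc n)))"
    proof
      fix z assume "z \<in> X - {z\<in>X. \<exists>\<epsilon>>0. \<forall>k. \<forall>y\<in>Y. \<epsilon> \<le> d ((T ^^ k) z) y}"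
      then obtain k y where z: "z \<in> X" "y \<in> Y" "d ((T ^^ k) z) y < \<epsilon>" using \<epsilon> by (auto simp: not_le)
      have lk: "\<kappa> ^ k \<ge> 1" using \<kappa> by simp
      have "(\<lambda>n. \<kappa> ^ k * \<rho> n) \<longlonglongrightarrow> \<kappa> ^ k * 0" using \<rho> by (intro tendsto_mult tendsto_const) auto
      then have "\<forall>\<^sub>F n in sequentially. \<kappa> ^ k * \<rho> n < C" using C by (intro order_tendstoD(2)) auto
      then have ex: "\<exists>n. \<kappa> ^ k * \<rho> n \<le> C" by (auto simp: eventually_sequentially intro: less_imp_le)
      \<comment> \<open>The least such \<open>n\<close> ends the window containing \<open>k\<close>.
        It is not 0 because \<open>C < \<rho>0\<close>, so a preceding turn exists.\<close>
      define n where "n = (LEAST n. \<kappa> ^ k * \<rho> n \<le> C)"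
      have n: "\<kappa> ^ k * \<rho> n \<le> C" unfolding n_def using ex by (rule LeastI_ex)
      have "1 * \<rho>0 \<le> \<kappa> ^ k * \<rho>0" using lk \<rho>0 by (intro mult_right_mono) auto
      then have "n \<noteq> 0" using n C \<rho> by (metis linorder_not_less mult_1 order_trans)
      then obtain m where m: "n = Suc m" by (cases n) auto
      have "\<not> \<kappa> ^ k * \<rho> m \<le> C" using not_less_Least[of m "\<lambda>n. \<kappa> ^ k * \<rho> n \<le> C"] m n_def by simp
      then have "z \<in> V (\<rho> m) (\<rho> (Suc m))" using n z by (auto simp: V_def m intro!: exI[of _ k])
      then show "z \<in> (\<Union>n. V (\<rho> n) (\<rho> (Suc n)))" by blast
    qed
  qed
qed

section \<open>Lifts of affine maps to the cover and their visits to rational points\<close>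

definition lift_map :: "rat \<Rightarrow> cover_pt \<Rightarrow> cover_pt \<Rightarrow> cover_pt" where
  "lift_map r \<alpha> x = (diag P r \<otimes>\<^bsub>cover P\<^esub> x) \<oplus>\<^bsub>cover P\<^esub> \<alpha>"

lemma lift_map_closed [simp]: "x \<in> X \<Longrightarrow> \<alpha> \<in> X \<Longrightarrow> lift_map r \<alpha> x \<in> X"
  by (simp add: lift_map_def)

lemma lift_map_funpow_closed [simp]: "x \<in> X \<Longrightarrow> \<alpha> \<in> X \<Longrightarrow> (lift_map r \<alpha> ^^ k) x \<in> X"
  by (induction k) auto

lemma place_dist_lift_map:
  assumes "i \<in> places" "x \<in> X" "y \<in> X" "\<alpha> \<in> X"
  shows "place_dist i (lift_map r \<alpha> x) (lift_map r \<alpha> y) = place_abs i r * place_dist i x y"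
  using assms by (simp add: lift_map_def place_dist_add_right place_dist_diag_mult)

text \<open>Each step multiplies a diagonal translation by \<open>r\<close>. For \<open>r\<close> in
  \<open>R\<close> the iterates therefore respect lattice cosets, which reduces questions about a
  whole fibre to one of its points.\<close>

lemma lift_map_funpow_add_diag:
  assumes "x \<in> X" "\<alpha> \<in> X"
  shows "(lift_map r \<alpha> ^^ l) (x \<oplus>\<^bsub>cover P\<^esub> diag P s) = (lift_map r \<alpha> ^^ l) x \<oplus>\<^bsub>cover P\<^esub> diag P (r ^ l * s)"
proof (induction l)
  case (Suc l)
  let ?z = "(lift_map r \<alpha> ^^ l) x"
  have car: "?z \<in> X" "diag P r \<in> X" "diag P (r ^ l * s) \<in> X" using assms by auto
  have "lift_map r \<alpha> (z \<oplus>\<^bsub>cover P\<^esub> u) = lift_map r \<alpha> z \<oplus>\<^bsub>cover P\<^esub> (diag P r \<otimes>\<^bsub>cover P\<^esub> u)"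
    if "z \<in> X" "u \<in> X" for z u
    using that assms(2) by (simp add: lift_map_def cover.r_distr cover.a_ac)
  then show ?case using Suc car by (simp add: mult.assoc flip: diag_mult)
qed simp

text \<open>The fibre of the projection to the solenoid over the image of the rational point
  \<open>t\<close>.\<close>

abbreviation target :: "rat \<Rightarrow> cover_pt set" where
  "target t \<equiv> (\<lambda>s. diag P (t + s)) ` R"

lemma target_separated:
  assumes "y \<in> target t" "y' \<in> target t" "y \<noteq> y'"
  shows "1 \<le> d y y'"
  using assms lattice_separated by fastforce

text \<open>By 1-separation, a target point at distance below 1/2 from \<open>w\<close> is the
  nearest one. If it differs from \<open>w\<close>, its distance serves as \<open>\<delta>\<close>;
  otherwise 1/2 does.\<close>

lemma target_isolated:
  assumes w: "w \<in> X"
  shows "\<exists>\<delta>>0. \<forall>y\<in>target t. d w y < \<delta> \<longrightarrow> w = y"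
proof (cases "\<exists>y\<in>target t. d w y < 1/2 \<and> w \<noteq> y")
  case True
  then obtain y where y: "y \<in> target t" "d w y < 1/2" "w \<noteq> y" by blast
  then have yX: "y \<in> X" by auto
  have "\<not> d w y' < d w y" if y': "y' \<in> target t" for y'
  proof
    assume lt: "d w y' < d w y"
    then have "1 \<le> d y y'" using target_separated[OF y(1) y'] by fastforce
    moreover have "d y y' \<le> d y w + d w y'" using y' yX w by (intro cover.triangle) auto
    ultimately show False using lt y(2) by (simp add: cover.commute)
  qed
  then show ?thesis using y w yX by (intro exI[of _ "d w y"]) auto
next
  case False
  then show ?thesis by (intro exI[of _ "1/2"]) auto
qed

text \<open>One \<open>\<delta>\<close> serves the infinitely many \<open>y\<close>: translating by
  a lattice element carries the image of \<open>y\<close> to the single point \<open>w\<close> and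
  keeps the target set in place, so isolation is needed at \<open>w\<close> only.\<close>

lemma target_images_separated:
  assumes r: "r \<in> R" and \<alpha>: "\<alpha> \<in> X"
  shows "\<exists>\<delta>>0. \<forall>y\<in>target t. \<forall>y'\<in>target t.
    d ((lift_map r \<alpha> ^^ l) y) y' < \<delta> \<longrightarrow> (lift_map r \<alpha> ^^ l) y = y'"
proof -
  define w where "w = (lift_map r \<alpha> ^^ l) (diag P t)"
  have w: "w \<in> X" using \<alpha> by (simp add: w_def)
  obtain \<delta> where \<delta>: "\<delta> > 0" "\<And>y. y \<in> target t \<Longrightarrow> d w y < \<delta> \<Longrightarrow> w = y"
    using target_isolated[OF w] by metis
  have "(lift_map r \<alpha> ^^ l) (diag P (t + s)) = diag P (t + s')"
    if s: "s \<in> R" "s' \<in> R" and lt: "d ((lift_map r \<alpha> ^^ l) (diag P (t + s))) (diag P (t + s')) < \<delta>" for s s'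
  proof -
    have 1: "(lift_map r \<alpha> ^^ l) (diag P (t + s)) = w \<oplus>\<^bsub>cover P\<^esub> diag P (r ^ l * s)"
      unfolding w_def diag_add[of t s] using \<alpha> by (intro lift_map_funpow_add_diag) auto
    have 2: "diag P (t + s') = diag P (t + (s' - r ^ l * s)) \<oplus>\<^bsub>cover P\<^esub> diag P (r ^ l * s)"
      by (simp flip: diag_add)
    have "s' - r ^ l * s \<in> R" using s r by (intro lattice_diff lattice_mult lattice_power)
    moreover have "d w (diag P (t + (s' - r ^ l * s))) < \<delta>"
      using lt unfolding 1 2 using w by (subst (asm) cover_dist_add_right) auto
    ultimately have "w = diag P (t + (s' - r ^ l * s))" using \<delta>(2) by blast
    then show ?thesis using 1 2 by simp
  qed
  then show ?thesis using \<delta>(1) by (intro exI[of _ \<delta>]) auto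
qed

definition avoiding :: "rat \<Rightarrow> cover_pt \<Rightarrow> rat \<Rightarrow> cover_pt set" where
  "avoiding r \<alpha> t = {z\<in>X. \<exists>\<epsilon>>0. \<forall>k. \<forall>y\<in>target t. \<epsilon> \<le> d ((lift_map r \<alpha> ^^ k) z) y}"

text \<open>The maximum of \<open>place_abs\<close> over the finite set \<open>insert 0 Q\<close> is
  the maximum over all places, since \<open>r\<close> is integral at the other primes. It exceeds 1:
  if the real absolute value does not, it is below 1, and then \<open>exists_large_place\<close>
  supplies a prime, which must lie in \<open>Q\<close>.\<close>

lemma manageable_avoiding:
  assumes Q: "finite Q" "Q \<subseteq> P" and r: "r \<in> invert_primes Q" "r \<in> R" "r \<noteq> 0" "r \<noteq> 1" "r \<noteq> -1"
    and \<alpha>: "\<alpha> \<in> X" and \<beta>: "0 < \<beta>"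
  shows "manageable \<beta> Q (avoiding r \<alpha> t)"
proof -
  define S where "S = (\<lambda>i. place_abs i r) ` insert 0 Q"
  have S: "finite S" "S \<noteq> {}" using Q by (auto simp: S_def)
  then have "Max S \<in> S" by (rule Max_in)
  then obtain i0 where i0: "i0 \<in> insert 0 Q" "place_abs i0 r = Max S" using S_def by (metis imageE)
  have small: "padic_abs_rat p r \<le> 1" if "p \<in> P - Q" for p
    using invert_primes_le_1[of Q p r] r(1) that Q(2) prime by blast
  have gt1: "Max S > 1"
  proof (cases "\<bar>r\<bar> < 1")
    case True
    then obtain p where p: "p \<in> P" "real p \<le> padic_abs_rat p r" using exists_large_place r by blast
    then have g: "padic_abs_rat p r > 1" using prime_gt_1_nat[OF prime[OF p(1)]] by linarith
    then have "p \<in> Q" using small[of p] p by force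
    then have "place_abs p r \<le> Max S" using S by (intro Max_ge) (auto simp: S_def)
    then show ?thesis using g P_pos[OF p(1)] by (simp add: place_abs_def)
  next
    case False
    then have "\<bar>r\<bar> > 1" using r by (auto simp: abs_if split: if_splits)
    then have "real_of_rat \<bar>r\<bar> > 1" by (metis of_rat_1 of_rat_less)
    then have "place_abs 0 r > 1" by (simp add: place_abs_def)
    moreover have "place_abs 0 r \<le> Max S" using S by (intro Max_ge) (auto simp: S_def)
    ultimately show ?thesis by simp
  qed
  have le: "place_abs i r \<le> Max S" if "i \<in> places" for i
  proof (cases "i \<in> insert 0 Q")
    case True
    then show ?thesis using S by (intro Max_ge) (auto simp: S_def)
  next
    case False
    then have "place_abs i r \<le> 1" using small[of i] that by (auto simp: place_abs_def)
    then show ?thesis using gt1 by simp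
  qed
  show ?thesis
    unfolding avoiding_def
    by (rule manageable_expanding[of "lift_map r \<alpha>" "\<lambda>i. place_abs i r" "Max S" i0])
      (use place_dist_lift_map \<alpha> le i0 Q gt1 \<beta> target_images_separated[OF r(2) \<alpha>] in auto)
qed


section \<open>The solenoid\<close>

abbreviation \<Lambda> where "\<Lambda> \<equiv> diag_lattice P"
abbreviation proj where "proj \<equiv> solenoid_proj P"
abbreviation \<S> where "\<S> \<equiv> carrier (solenoid P)"

lemma mem_lattice: "diag P s \<in> \<Lambda> \<longleftrightarrow> s \<in> R"
  by (auto simp: diag_lattice_def)

sublocale lattice: abelian_subgroup \<Lambda> "cover P"
proof (rule abelian_subgroupI3)
  show "additive_subgroup \<Lambda> (cover P)"
  proof (rule additive_subgroupI, rule cover.add.subgroupI)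
    show "\<Lambda> \<noteq> {}" using mem_lattice[of 0] by auto
    show "\<ominus>\<^bsub>cover P\<^esub> x \<in> \<Lambda>" if "x \<in> \<Lambda>" for x
      using that lattice_minus by (auto simp: diag_lattice_def simp flip: diag_minus)
    show "x \<oplus>\<^bsub>cover P\<^esub> y \<in> \<Lambda>" if "x \<in> \<Lambda>" "y \<in> \<Lambda>" for x y
      using that lattice_add by (auto simp: diag_lattice_def simp flip: diag_add)
  qed (auto simp: diag_lattice_def)
qed (rule cover.abelian_group_axioms)

lemma solenoid_carrier: "\<S> = proj ` X"
  by (auto simp: solenoid_def A_FactGroup_def' A_RCOSETS_def' solenoid_proj_def)

lemma proj_closed [simp]: "x \<in> X \<Longrightarrow> proj x \<in> \<S>"
  by (simp add: solenoid_carrier)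

lemma mem_proj: "x \<in> X \<Longrightarrow> y \<in> proj x \<longleftrightarrow> (\<exists>s\<in>R. y = x \<oplus>\<^bsub>cover P\<^esub> diag P s)"
  by (auto simp: solenoid_proj_def a_r_coset_def' diag_lattice_def cover.a_comm)

lemma proj_eq_iff:
  assumes "x \<in> X" "y \<in> X"
  shows "proj y = proj x \<longleftrightarrow> (\<exists>s\<in>R. y = x \<oplus>\<^bsub>cover P\<^esub> diag P s)"
proof
  assume "proj y = proj x"
  moreover have "y \<in> proj y" using assms unfolding mem_proj[OF assms(2)]
    by (intro bexI[of _ 0]) (auto simp: diag_0)
  ultimately show "\<exists>s\<in>R. y = x \<oplus>\<^bsub>cover P\<^esub> diag P s" using mem_proj assms by blast
next
  assume "\<exists>s\<in>R. y = x \<oplus>\<^bsub>cover P\<^esub> diag P s"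
  then have "y \<in> proj x" using mem_proj assms by blast
  then show "proj y = proj x"
    unfolding solenoid_proj_def
    using cover.a_repr_independence[OF _ assms(1) lattice.a_subgroup] by metis
qed

lemma solenoid_mult: "x \<in> X \<Longrightarrow> y \<in> X \<Longrightarrow> proj x \<otimes>\<^bsub>solenoid P\<^esub> proj y = proj (x \<oplus>\<^bsub>cover P\<^esub> y)"
  by (simp add: solenoid_def solenoid_proj_def lattice.a_rcos_sum)

lemma solenoid_one: "\<one>\<^bsub>solenoid P\<^esub> = proj \<zero>\<^bsub>cover P\<^esub>"
  using cover.a_coset_add_zero[OF lattice.a_subset]
  by (simp add: solenoid_def A_FactGroup_def' solenoid_proj_def)

lemma smult_proj:
  assumes r: "r \<in> R" and x: "x \<in> X"
  shows "solenoid_smult P r (proj x) = proj (diag P r \<otimes>\<^bsub>cover P\<^esub> x)"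
proof -
  have "proj (diag P r \<otimes>\<^bsub>cover P\<^esub> y) = proj (diag P r \<otimes>\<^bsub>cover P\<^esub> x)" if y: "y \<in> proj x" for y
  proof -
    obtain s where s: "s \<in> R" "y = x \<oplus>\<^bsub>cover P\<^esub> diag P s" using y mem_proj x by blast
    then have "diag P r \<otimes>\<^bsub>cover P\<^esub> y = diag P r \<otimes>\<^bsub>cover P\<^esub> x \<oplus>\<^bsub>cover P\<^esub> diag P (r * s)"
      using x by (simp add: cover.r_distr diag_mult)
    then show ?thesis using lattice_mult[OF r s(1)] x s by (subst proj_eq_iff) auto
  qed
  moreover have "x \<in> proj x" using proj_eq_iff[OF x x] mem_proj[OF x] by blast
  ultimately show ?thesis unfolding solenoid_smult_def by blast
qed

lemma affine_map_proj:
  assumes "r \<in> R" "x \<in> X" "\<alpha> \<in> X"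
  shows "affine_map P r (proj \<alpha>) (proj x) = proj (lift_map r \<alpha> x)"
  using assms by (simp add: affine_map_def smult_proj solenoid_mult lift_map_def)

lemma affine_map_funpow_proj:
  assumes "r \<in> R" "x \<in> X" "\<alpha> \<in> X"
  shows "(affine_map P r (proj \<alpha>) ^^ k) (proj x) = proj ((lift_map r \<alpha> ^^ k) x)"
  using assms by (induction k) (auto simp: affine_map_proj)

text \<open>The abstraction \<open>topology\<close> is informative only for families closed under
  finite intersections and arbitrary unions; both properties pass through preimages.\<close>

lemma openin_solenoid_topology:
  "openin (solenoid_topology P) U \<longleftrightarrow>
    U \<subseteq> \<S> \<and> openin (cover_topology P) (solenoid_preimage P U)"
proof -
  have "istopology (\<lambda>U. U \<subseteq> \<S> \<and> openin (cover_topology P) (solenoid_preimage P U))"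
    unfolding istopology_def
  proof (intro conjI allI impI)
    fix S T assume "S \<subseteq> \<S> \<and> openin (cover_topology P) (solenoid_preimage P S)"
      "T \<subseteq> \<S> \<and> openin (cover_topology P) (solenoid_preimage P T)"
    moreover have "solenoid_preimage P (S \<inter> T) = solenoid_preimage P S \<inter> solenoid_preimage P T"
      by (auto simp: solenoid_preimage_def)
    ultimately show "S \<inter> T \<subseteq> \<S>" "openin (cover_topology P) (solenoid_preimage P (S \<inter> T))"
      by (auto intro: openin_Int)
  next
    fix K assume "\<forall>S\<in>K. S \<subseteq> \<S> \<and> openin (cover_topology P) (solenoid_preimage P S)"
    moreover have "solenoid_preimage P (\<Union>K) = (\<Union>S\<in>K. solenoid_preimage P S)"
      by (auto simp: solenoid_preimage_def)
    ultimately show "\<Union>K \<subseteq> \<S>" "openin (cover_topology P) (solenoid_preimage P (\<Union>K))"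
      by (auto intro!: openin_Union)
  qed
  then show ?thesis unfolding solenoid_topology_def by (simp add: topology_inverse')
qed

text \<open>The \<open>\<epsilon>\<close>-neighbourhood \<open>W\<close> of the fibre is invariant
  under lattice translations, hence the full preimage of its image. That image is therefore an open
  neighbourhood of the rational point, and the orbit of \<open>proj z\<close> never enters
  it.\<close>

lemma not_in_orbit_closure:
  assumes r: "r \<in> R" and \<alpha>: "\<alpha> \<in> X" and z: "z \<in> avoiding r \<alpha> t"
  shows "proj (diag P t) \<notin> solenoid_topology P closure_of {(affine_map P r (proj \<alpha>) ^^ k) (proj z) | k. k \<ge> 0}"
proof
  assume cl: "proj (diag P t) \<in> solenoid_topology P closure_of {(affine_map P r (proj \<alpha>) ^^ k) (proj z) | k. k \<ge> 0}"
  obtain \<epsilon> where zX: "z \<in> X" and \<epsilon>: "\<epsilon> > 0" "\<And>k y. y \<in> target t \<Longrightarrow> \<epsilon> \<le> d ((lift_map r \<alpha> ^^ k) z) y"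
    using z unfolding avoiding_def by blast
  define W where "W = (\<Union>y\<in>target t. cover.mball y \<epsilon>)"
  have WX: "W \<subseteq> X" by (auto simp: W_def)
  have shift_W: "x \<oplus>\<^bsub>cover P\<^esub> diag P s \<in> W" if xW: "x \<in> W" and s: "s \<in> R" for x s
  proof -
    obtain s' where s': "s' \<in> R" "d (diag P (t + s')) x < \<epsilon>" "x \<in> X" using xW by (auto simp: W_def)
    then have "d (diag P (t + s') \<oplus>\<^bsub>cover P\<^esub> diag P s) (x \<oplus>\<^bsub>cover P\<^esub> diag P s) < \<epsilon>"
      by (subst cover_dist_add_right) auto
    then have "x \<oplus>\<^bsub>cover P\<^esub> diag P s \<in> cover.mball (diag P (t + (s' + s))) \<epsilon>"
      using s' by (simp add: add.assoc flip: diag_add)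
    moreover have "diag P (t + (s' + s)) \<in> target t" using lattice_add[OF s'(1) s] by blast
    ultimately show ?thesis unfolding W_def by blast
  qed
  have pre: "solenoid_preimage P (proj ` W) = W"
  proof
    show "W \<subseteq> solenoid_preimage P (proj ` W)" using WX by (auto simp: solenoid_preimage_def)
    show "solenoid_preimage P (proj ` W) \<subseteq> W"
    proof
      fix x assume "x \<in> solenoid_preimage P (proj ` W)"
      then obtain w where w: "w \<in> W" "x \<in> X" "proj x = proj w" by (auto simp: solenoid_preimage_def)
      then obtain s where "s \<in> R" "x = w \<oplus>\<^bsub>cover P\<^esub> diag P s" using proj_eq_iff[of w x] WX by blast
      then show "x \<in> W" using shift_W w by blast
    qed
  qed
  have oW: "openin (solenoid_topology P) (proj ` W)"
    unfolding openin_solenoid_topology pre using WX by (auto simp: W_def intro!: openin_Union)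
  have tW: "diag P t \<in> W" unfolding W_def using \<epsilon>(1) by (intro UN_I[of "diag P (t + 0)"] imageI) auto
  then have "proj (diag P t) \<in> proj ` W" by (rule imageI)
  then obtain k where "(affine_map P r (proj \<alpha>) ^^ k) (proj z) \<in> proj ` W"
    using cl[unfolded in_closure_of, THEN conjunct2, rule_format, OF conjI, OF _ oW] by blast
  then have "proj ((lift_map r \<alpha> ^^ k) z) \<in> proj ` W" using affine_map_funpow_proj[OF r zX \<alpha>] by metis
  then have "(lift_map r \<alpha> ^^ k) z \<in> W"
    using pre zX \<alpha> by (auto simp: solenoid_preimage_def)
  then obtain y where y: "y \<in> target t" "d y ((lift_map r \<alpha> ^^ k) z) < \<epsilon>"
    unfolding W_def cover.mball_def by blast
  then show False using \<epsilon>(2)[OF y(1), of k] by (simp add: cover.commute)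
qed

text \<open>\<open>(B ^ q - 1) x = s\<close> has the rational solution \<open>s / (B ^ q - 1)\<close> in every coordinate.\<close>

lemma periodic_orbit_rational:
  assumes S: "periodic_orbit P B S" and B: "B \<in> R" "B \<noteq> 1" "B \<noteq> -1"
  obtains t where "proj (diag P t) \<in> S"
proof -
  obtain y q where y: "y \<in> \<S>" and q: "q \<ge> 1" "solenoid_smult P (B ^ q) y = y"
    and S_eq: "S = {solenoid_smult P (B ^ k) y | k. k \<ge> 0}"
    using S unfolding periodic_orbit_def by blast
  obtain x where x: "x \<in> X" "y = proj x" using y by (auto simp: solenoid_carrier)
  define r where "r = B ^ q"
  have r: "r \<in> R" using lattice_power B by (simp add: r_def)
  \<comment> \<open>A rational number some positive power of which is 1 has absolute value 1, so it
    would be 1 or -1.\<close>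
  have "r \<noteq> 1"
  proof
    assume "r = 1"
    then have "\<bar>B\<bar> ^ q = 1" by (simp add: r_def flip: power_abs)
    then have "\<bar>B\<bar> = 1" using q(1) power_eq_imp_eq_base[of "\<bar>B\<bar>" q 1] by simp
    then show False using B by (auto simp: abs_if split: if_splits)
  qed
  have "proj (diag P r \<otimes>\<^bsub>cover P\<^esub> x) = proj x"
    using q(2) smult_proj[OF r x(1)] x(2) by (simp add: r_def)
  then obtain s where s: "diag P r \<otimes>\<^bsub>cover P\<^esub> x = x \<oplus>\<^bsub>cover P\<^esub> diag P s"
    using proj_eq_iff[OF x(1), of "diag P r \<otimes>\<^bsub>cover P\<^esub> x"] x(1) by auto
  define t where "t = s / (r - 1)"
  have "diag P (r - 1) \<otimes>\<^bsub>cover P\<^esub> x = diag P r \<otimes>\<^bsub>cover P\<^esub> x \<ominus>\<^bsub>cover P\<^esub> x"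
    using x by (simp add: diag_diff diag_1 a_minus_def cover.l_distr cover.l_minus)
  also have "\<dots> = diag P s"
    unfolding s using x by (simp add: a_minus_def cover.a_comm[of x] cover.a_assoc cover.r_neg)
  finally have e: "diag P (r - 1) \<otimes>\<^bsub>cover P\<^esub> x = diag P s" .
  have "x = diag P (inverse (r - 1) * (r - 1)) \<otimes>\<^bsub>cover P\<^esub> x"
    using \<open>r \<noteq> 1\<close> x by (simp add: diag_1)
  also have "\<dots> = diag P (inverse (r - 1)) \<otimes>\<^bsub>cover P\<^esub> (diag P (r - 1) \<otimes>\<^bsub>cover P\<^esub> x)"
    unfolding diag_mult using x by (intro cover.m_assoc) auto
  also have "\<dots> = diag P t" unfolding e by (simp add: t_def divide_inverse mult.commute flip: diag_mult)
  finally have "proj (diag P t) = solenoid_smult P (B ^ q) y" using q(2) x by simp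
  then show ?thesis using that[of t] S_eq by blast
qed

text \<open>Here \<open>lift_map r \<alpha>\<close> is the identity or a reflection.\<close>

lemma avoiding_involution:
  assumes r: "r = 1 \<or> r = -1" and \<alpha>: "\<alpha> \<in> X" "r = 1 \<Longrightarrow> \<alpha> = \<zero>\<^bsub>cover P\<^esub>"
  shows "\<exists>N. countable N \<and> N \<subseteq> X \<and> X - N \<subseteq> avoiding r \<alpha> t"
proof -
  let ?T = "lift_map r \<alpha>"
  have inv: "?T (?T z) = z" if z: "z \<in> X" for z
    using r
  proof
    assume "r = 1"
    then show ?thesis using \<alpha> z by (simp add: lift_map_def diag_1)
  next
    assume "r = -1"
    then show ?thesis
      using \<alpha>(1) z by (simp add: lift_map_def diag_minus diag_1 cover.l_minus cover.minus_add cover.a_assoc cover.l_neg)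
  qed
  have orbit: "(?T ^^ k) z = z \<or> (?T ^^ k) z = ?T z" if "z \<in> X" for k z
    by (induction k) (use inv[OF that] in auto)
  \<comment> \<open>An orbit consists of \<open>z\<close> and \<open>?T z\<close> only. As
    \<open>?T\<close> is its own inverse, \<open>?T z\<close> is a target point exactly when
    \<open>z\<close> lies in the image of the target.\<close>
  define N where "N = target t \<union> ?T ` target t"
  have "countable (target t)" by (simp add: countable_subset[OF subset_UNIV] uncountable_def)
  then have "countable N" by (simp add: N_def)
  moreover have "N \<subseteq> X" using \<alpha> by (auto simp: N_def)
  moreover have "z \<in> avoiding r \<alpha> t" if z: "z \<in> X - N" for z
  proof -
    have zX: "z \<in> X" "?T z \<in> X" using z \<alpha> by auto
    obtain \<delta>1 where \<delta>1: "\<delta>1 > 0" "\<And>y. y \<in> target t \<Longrightarrow> d z y < \<delta>1 \<Longrightarrow> z = y"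
      using target_isolated[OF zX(1)] by metis
    obtain \<delta>2 where \<delta>2: "\<delta>2 > 0" "\<And>y. y \<in> target t \<Longrightarrow> d (?T z) y < \<delta>2 \<Longrightarrow> ?T z = y"
      using target_isolated[OF zX(2)] by metis
    have "min \<delta>1 \<delta>2 \<le> d ((?T ^^ k) z) y" if y: "y \<in> target t" for k y
    proof -
      have "z \<noteq> y" using z y by (auto simp: N_def)
      moreover have "?T z \<noteq> y"
      proof
        assume "?T z = y"
        then have "z = ?T y" using inv[OF zX(1)] by simp
        then show False using z y by (auto simp: N_def)
      qed
      ultimately have "\<delta>1 \<le> d z y" "\<delta>2 \<le> d (?T z) y" using \<delta>1(2)[OF y] \<delta>2(2)[OF y] by force+
      then show ?thesis using orbit[OF zX(1), of k] by auto
    qed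
    then show ?thesis using zX \<delta>1(1) \<delta>2(1) unfolding avoiding_def
      by (intro CollectI conjI exI[of _ "min \<delta>1 \<delta>2"]) auto
  qed
  ultimately show ?thesis by blast
qed

text \<open>\<open>F\<close> is defined without reference to \<open>B\<close>: its points keep every
  rational point out of all the orbit closures, and each relevant periodic orbit contains a rational
  point. A countable family of tasks then suffices.\<close>

theorem avoid_periodic_orbits:
  fixes r :: "nat \<Rightarrow> rat" and a :: "nat \<Rightarrow> solenoid_pt"
  assumes Q: "finite Q" "Q \<subseteq> P" and r: "\<And>j. r j \<in> R" "\<And>j. r j \<noteq> 0" "\<And>j. r j \<in> invert_primes Q"
    and a: "\<And>j. a j \<in> \<S>" "\<And>j. r j = 1 \<Longrightarrow> a j = \<one>\<^bsub>solenoid P\<^esub>"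
  shows "\<exists>F. solenoid_CAW P F \<and>
    (\<forall>x\<in>F. \<forall>j. \<forall>B\<in>R - {1, -1}. \<forall>S. periodic_orbit P B S \<longrightarrow>
      \<not> S \<subseteq> solenoid_topology P closure_of {(affine_map P (r j) (a j) ^^ k) x | k. k \<ge> 0})"
proof -
  \<comment> \<open>For \<open>r j = 1\<close> the lift of 0 has to be chosen as 0 itself: another
    lattice point would make the lifted map a translation with infinite orbits instead of the
    identity.\<close>
  have "\<exists>\<alpha>\<in>X. a j = proj \<alpha> \<and> (r j = 1 \<longrightarrow> \<alpha> = \<zero>\<^bsub>cover P\<^esub>)" for j
    using a[of j] solenoid_one by (cases "r j = 1") (auto simp: solenoid_carrier)
  then obtain \<alpha> where \<alpha>: "\<And>j. \<alpha> j \<in> X" "\<And>j. a j = proj (\<alpha> j)" "\<And>j. r j = 1 \<Longrightarrow> \<alpha> j = \<zero>\<^bsub>cover P\<^esub>"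
    by metis
  define F where "F = {x\<in>\<S>. \<forall>j t. proj (diag P t) \<notin>
    solenoid_topology P closure_of {(affine_map P (r j) (a j) ^^ k) x | k. k \<ge> 0}}"
  have "\<exists>N. countable N \<and> N \<subseteq> X \<and> (r j = 1 \<or> r j = -1 \<longrightarrow> X - N \<subseteq> avoiding (r j) (\<alpha> j) t)" for j t
    using avoiding_involution[of "r j" "\<alpha> j" t] \<alpha> by blast
  then obtain N where N: "\<And>j t. countable (N j t)" "\<And>j t. N j t \<subseteq> X"
    and N_avoid: "\<And>j t. r j = 1 \<or> r j = -1 \<Longrightarrow> X - N j t \<subseteq> avoiding (r j) (\<alpha> j) t"
    by metis
  \<comment> \<open>All tasks in one countable family. The first member is a harmless extra task
    that makes the family nonempty, so that \<open>from_nat_into\<close> enumerates it.\<close>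
  define \<G> where "\<G> = insert (X - {\<zero>\<^bsub>cover P\<^esub>})
    ((\<lambda>(j, t). avoiding (r j) (\<alpha> j) t) ` ({j. r j \<noteq> 1 \<and> r j \<noteq> -1} \<times> UNIV)
      \<union> (\<lambda>w. X - {w}) ` (\<Union>j. \<Union>t. N j t))"
  have "countable ({j. r j \<noteq> 1 \<and> r j \<noteq> -1} \<times> (UNIV :: rat set))" by simp
  moreover have "countable (\<Union>j. \<Union>t. N j t)" using N by (intro countable_UN) auto
  ultimately have \<G>: "countable \<G>" "\<G> \<noteq> {}" by (simp_all add: \<G>_def)
  then have range: "range (from_nat_into \<G>) = \<G>" by (rule range_from_nat_into[rotated])
  have avoid: "z \<in> avoiding (r j) (\<alpha> j) t" if z: "z \<in> X" "\<And>G. G \<in> \<G> \<Longrightarrow> z \<in> G" for z j t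
  proof (cases "r j = 1 \<or> r j = -1")
    case True
    have "z \<notin> N j t"
    proof
      assume "z \<in> N j t"
      then have "X - {z} \<in> \<G>" by (auto simp: \<G>_def)
      then show False using z by blast
    qed
    then show ?thesis using N_avoid[OF True, of t] z by blast
  next
    case False
    then have "avoiding (r j) (\<alpha> j) t \<in> \<G>" by (auto simp: \<G>_def)
    then show ?thesis using z by blast
  qed
  have cases: "(\<exists>w\<in>X. G = X - {w}) \<or> (\<exists>j t. r j \<noteq> 1 \<and> r j \<noteq> -1 \<and> G = avoiding (r j) (\<alpha> j) t)"
    if "G \<in> \<G>" for G
    using that unfolding \<G>_def
  proof (elim insertE UnE imageE)
    fix w assume "G = X - {w}" "w \<in> (\<Union>j. \<Union>t. N j t)"
    then show ?thesis using N(2) by blast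
  qed auto
  have sub: "X \<inter> (\<Inter>n. from_nat_into \<G> n) \<subseteq> solenoid_preimage P F"
  proof
    fix z assume z: "z \<in> X \<inter> (\<Inter>n. from_nat_into \<G> n)"
    then have zG: "z \<in> G" if "G \<in> \<G>" for G using that range by auto
    have "proj (diag P t) \<notin> solenoid_topology P closure_of {(affine_map P (r j) (a j) ^^ k) (proj z) | k. k \<ge> 0}"
      for j t
      unfolding \<alpha>(2) using z zG by (intro not_in_orbit_closure r \<alpha>(1) avoid) auto
    then show "z \<in> solenoid_preimage P F" using z by (simp add: F_def solenoid_preimage_def)
  qed
  \<comment> \<open>Below this bound \<open>\<beta>\<close> is at most 1/3 and
    \<open>\<beta> * real q < 1\<close> holds for all \<open>q\<close> in \<open>Q\<close>. A sum,
    unlike a maximum, also covers the case that \<open>Q\<close> is empty.\<close>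
  define \<beta>0 :: real where "\<beta>0 = 1 / (3 + real (\<Sum>Q))"
  have "\<exists>\<sigma>. winning_strategy P \<beta> (solenoid_preimage P F) \<sigma>" if \<beta>: "0 < \<beta>" "\<beta> < \<beta>0" for \<beta>
  proof (rule winning_strategy_manageable[OF Q(2) \<beta>(1) _ _ _ sub])
    have "3 + real (\<Sum>Q) > 0" by linarith
    then have lt: "\<beta> * (3 + real (\<Sum>Q)) < 1" using \<beta> unfolding \<beta>0_def by (simp only: pos_less_divide_eq)
    moreover have "\<beta> * real (\<Sum>Q) \<ge> 0" using \<beta> by (intro mult_nonneg_nonneg) (auto intro: sum_nonneg)
    ultimately show "\<beta> \<le> 1/3" by (simp add: algebra_simps)
    show "\<beta> * real q < 1" if "q \<in> Q" for q
    proof -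
      have "q \<le> \<Sum>Q" using that Q by (intro member_le_sum[of q Q "\<lambda>q. q"]) auto
      then have "real q \<le> 3 + real (\<Sum>Q)" by linarith
      then have "\<beta> * real q \<le> \<beta> * (3 + real (\<Sum>Q))" using \<beta> by (intro mult_left_mono) auto
      then show ?thesis using lt by linarith
    qed
    show "manageable \<beta> Q (from_nat_into \<G> n)" for n
    proof -
      have "from_nat_into \<G> n \<in> \<G>" using \<G> by (intro from_nat_into) auto
      then consider w where "w \<in> X" "from_nat_into \<G> n = X - {w}"
        | j t where "r j \<noteq> 1" "r j \<noteq> -1" "from_nat_into \<G> n = avoiding (r j) (\<alpha> j) t"
        using cases by blast
      then show ?thesis
      proof cases
        case 1
        then show ?thesis using manageable_remove_point \<beta> by simp
      next
        case 2
        then show ?thesis using manageable_avoiding[OF Q r(3,1,2) _ _ \<alpha>(1) \<beta>(1)] by simp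
      qed
    qed
  qed
  moreover have "0 < \<beta>0" "\<beta>0 \<le> 1/3"
  proof -
    have "3 \<le> 3 + real (\<Sum>Q)" by linarith
    then show "0 < \<beta>0" "\<beta>0 \<le> 1/3" unfolding \<beta>0_def by (auto intro: divide_left_mono simp del: of_nat_sum)
  qed
  ultimately have "cylinder_absolute_winning P (solenoid_preimage P F)"
    unfolding cylinder_absolute_winning_def by (auto simp: solenoid_preimage_def)
  then have "solenoid_CAW P F" by (simp add: solenoid_CAW_def F_def)
  moreover have "\<not> S \<subseteq> solenoid_topology P closure_of {(affine_map P (r j) (a j) ^^ k) x | k. k \<ge> 0}"
    if x: "x \<in> F" and B: "B \<in> R - {1, -1}" and S: "periodic_orbit P B S" for x j B S
  proof -
    obtain t where "proj (diag P t) \<in> S" using periodic_orbit_rational[OF S] B by blast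
    then show ?thesis using x unfolding F_def by blast
  qed
  ultimately show ?thesis by blast
qed

end

theorem theorem1p1:
  fixes P :: "nat set"
    and m n :: "nat \<Rightarrow> int"
    and a :: "nat \<Rightarrow> solenoid_pt"
  assumes "\<forall>p\<in>P. prime p"
    and "\<forall>j. n j \<noteq> 0 \<and> (of_int (m j) / of_int (n j) :: rat) \<in> invert_primes P - {0}"
    and "\<forall>j. a j \<in> carrier (solenoid P)"
    and "\<nexists>j. (of_int (m j) / of_int (n j) :: rat) = 1 \<and> a j \<noteq> \<one>\<^bsub>solenoid P\<^esub>"
    and "\<exists>Q. finite Q \<and> Q \<subseteq> P \<and>
           (\<forall>j. (of_int (m j) / of_int (n j) :: rat) \<in> invert_primes Q)"
  shows "\<exists>F. solenoid_CAW P F \<and>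
           (\<forall>x\<in>F. \<forall>j. \<forall>B\<in>invert_primes P - {1, -1}. \<forall>S. periodic_orbit P B S \<longrightarrow>
              \<not> S \<subseteq> solenoid_topology P closure_of
                     {(affine_map P (of_int (m j) / of_int (n j)) (a j) ^^ k) x | k. k \<ge> 0})"
proof -
  interpret prime_set P using assms(1) by unfold_locales blast
  obtain Q where "finite Q" "Q \<subseteq> P"
    "\<forall>j. (of_int (m j) / of_int (n j) :: rat) \<in> invert_primes Q"
    using assms(5) by blast
  then show ?thesis
    using assms(2-4) by (intro avoid_periodic_orbits[of Q "\<lambda>j. of_int (m j) / of_int (n j)" a]) auto
qed

end
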